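(* Consider the nonlinear semi-discrete scheme $$(P\otimes I_M)\vec U_t+\mathbf{D}_{x_i}\mathbf{A}_i\vec U+\mathbf{A}_i^T\mathbf{D}_{x_i}\vec U+\mathbf{C}\vec U+\vec L_D=0,\qquad \vec U(0)=\vec F,$$ with discrete lifting operator $$\vec L_D=(I_n\otimes P_\Omega^{-1})(DC)\vec L_C,\qquad DC=(I_n\otimes E^T)(P_{erm})^T(P_{\partial\Omega}\otimes I_n),$$ where $\vec L_C$ is the vector obtained by stacking $(L_C)_1,\dots,(L_C)_N$ with $$(L_C)_j=\big(2(J^-T^{-1})^T\Sigma(\vec W^--R\vec W^+-S^{-1}\vec G)\big)_j,\qquad j=1,\dots,N .$$ (a) The scheme is nonlinearly stable for $\vec G=0$ if, at each boundary node, $\Lambda^+-R^T|\Lambda^-|R\ge0$ and $\Sigma=|\Lambda^-|$ hold, and then the solution satisfies the estimate $$\|\vec U\|^2_{P\otimes P_\Omega}\le\|\vec F\|^2_{P\otimes P_\Omega}.$$ (b) The scheme is strongly nonlinearly stable for $\vec G\ne0$ if, at each boundary node, $\Lambda^+-R^T|\Lambda^-|R>0$ (strict inequality), $S=\tilde S^{-1}|\Lambda^-|^{1/2}$ with $\tilde S$ sufficiently small, and $\Sigma=|\Lambda^-|$ hold, and then the solution satisfies the estimate $$\|\vec U\|^2_{P\otimes P_\Omega}\le\|\vec F\|^2_{P\otimes P_\Omega}+2\int_0^t\sum_{j=1}^N\big[\vec G^T\vec G\big]_j\,ds_j\,dt .$$ Here $\vec F$ and $\vec G$ are external data, obtained from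 $F$ and $G$ by injection in the nodes.
   Context: Continuous problem being approximated (Einstein summation over $i=1,\dots,k$): $PU_t+(A_iU)_{x_i}+A_i^TU_{x_i}+CU+L_C=0$ in $\Omega\subset\mathbb{R}^k$, $U(\vec x,0)=F(\vec x)$, where $U$ has $n$ components, $A_i=A_i(U)$ and $C=C(U)$ are smooth $n\times n$ matrix functions, $C+C^T=0$, and $P$ is a constant symmetric positive (semi-)definite $n\times n$ matrix. The boundary conditions are $W^-=RW^++S^{-1}G$ on $\partial\Omega$ in the rotated variables below, with $G$ given data, imposed weakly through $L_C$. Rotated variables. Let $\tilde A=\frac12\big((n_iA_i)+(n_iA_i)^T\big)$, $n_i$ being the components of the outward normal. $T$ is a non-singular (possibly solution-dependent) matrix and $W=T^{-1}U$ is such that $U^T\tilde AU=W^T\Lambda W$ with $\Lambda=\mathrm{diag}(\lambda_i)$ (possibly solution-dependent). $\Lambda^+$, $\Lambda^-$ are the diagonal blocks of positive and negative entries of $\Lambda$, and $W^\pm=J^\pm W$ the corresponding components of $W$ ($J^\pm$ selection matrices), so $W^T\Lambda W=(W^+)^T\Lambda^+W^++(W^-)^T\Lambda^-W^-$. $|\Lambda^-|=\mathrm{diag}(|\lambda_i^-|)$, $|\Lambda^-|^{1/2}=\mathrm{diag}(\sqrt{|\lambda_i^-|})$. $S$ is non-singular; $R,S,\Sigma$ may be solution-dependent. "$\tilde S$ sufficiently small" means that $\tilde S$ is non-singular and, at each boundary node and time, $\|\tilde S\|\le\delta$ for some $\delta>0$ which may depend on $\Lambda^+,\Lambda^-,R$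 there. Matrix inequalities are in the sense of symmetric (semi-)definite matrices. Discretisation. There are $M$ nodes, $N$ of which are boundary nodes. $\vec U=(\vec U_1^T,\dots,\vec U_n^T)^T$, where $\vec U_m\in\mathbb{R}^M$ approximates the $m$-th component of $U$ in the nodes. $\mathbf{A}_i$ and $\mathbf{C}$ are $n\times n$ block matrices whose $(p,q)$ block is the diagonal $M\times M$ matrix containing the node values of the $(p,q)$ entry of $A_i$, respectively $C$ (evaluated at the discrete solution). $\mathbf{D}_{x_i}=I_n\otimes D_{x_i}$, $D_{x_i}=P_\Omega^{-1}Q_{x_i}$, with $P_\Omega$ a positive definite diagonal $M\times M$ volume quadrature matrix. $E$ is the $N\times M$ restriction operator extracting the boundary node values ($E\vec U$ also denotes $(I_n\otimes E)\vec U$). $P_{\partial\Omega}=\mathrm{diag}(ds_1,\dots,ds_N)$ is a positive definite diagonal boundary quadrature, and $N_i$ is the diagonal matrix of the $i$-th component of the discrete outward normal in the boundary nodes. The summation-by-parts property is $$Q_{x_i}+Q_{x_i}^T=E^TP_{\partial\Omega}N_iE,\qquad i=1,\dots,k .$$ $P_{erm}$ is the permutation matrix that reorders $(E\vec U_1,\dots,E\vec U_n)^T$ into $((E\vec U)_1,\dots,(E\vec U)_N)^T$, where $(E\vec U)_j\in\mathbb{R}^n$ collects the $n$ variables at boundary node $j$. The subscript $j$ or bracket $[\,\cdot\,]_j$ denotes evaluation at boundary node $j$, with the rotated variables given by $\vec W_j=(T^{-1}(E\vec U))_j$, $T$, $\Lambda$, $R,S,\Sigma$ evaluated at the discrete solution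 and discrete normal in that node. The norm is $\|\vec U\|^2_{P\otimes P_\Omega}=\vec U^T(P\otimes P_\Omega)\vec U$. "Nonlinearly stable" and "strongly nonlinearly stable" mean that the respective estimates stated hold for all $t\geq 0$ for which the solution exists. *)

theory Defs
  imports
    "HOL-Analysis.Analysis"
    "Jordan_Normal_Form.Gauss_Jordan_Elimination"
begin

no_notation Finite_Cartesian_Product.vec_nth (infixl \<open>$\<close> 90)
no_notation inner (infix \<open>\<bullet>\<close> 70)
hide_const (open) Finite_Cartesian_Product.vec Finite_Cartesian_Product.mat
  Determinants.det Finite_Cartesian_Product.row Finite_Cartesian_Product.column

section \<open>Matrix notions\<close>

text \<open>Only used for non-singular matrices.\<close>

definition minv :: "real mat \<Rightarrow> real mat" where
  "minv B = the (mat_inverse B)"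

definition kron :: "real mat \<Rightarrow> real mat \<Rightarrow> real mat" where
  "kron B B' = mat (dim_row B * dim_row B') (dim_col B * dim_col B')
     (\<lambda>(r, c). B $$ (r div dim_row B', c div dim_col B') * B' $$ (r mod dim_row B', c mod dim_col B'))"

definition pos_semidef :: "real mat \<Rightarrow> bool" where
  "pos_semidef B \<longleftrightarrow> square_mat B \<and> B\<^sup>T = B \<and> (\<forall>x\<in>carrier_vec (dim_row B). 0 \<le> x \<bullet> (B *\<^sub>v x))"

definition pos_def :: "real mat \<Rightarrow> bool" where
  "pos_def B \<longleftrightarrow> square_mat B \<and> B\<^sup>T = B \<and>
     (\<forall>x\<in>carrier_vec (dim_row B). x \<noteq> 0\<^sub>v (dim_row B) \<longrightarrow> 0 < x \<bullet> (B *\<^sub>v x))"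

text \<open>The operator norm induced by the Euclidean vector norm.\<close>

definition mat_norm :: "real mat \<Rightarrow> real" where
  "mat_norm B = Sup {sqrt ((B *\<^sub>v x) \<bullet> (B *\<^sub>v x)) | x. x \<in> carrier_vec (dim_col B) \<and> x \<bullet> x \<le> 1}"

text \<open>\<open>J\<close> extracts from a vector of length \<open>n\<close> the components with indices in \<open>K\<close>, in some order.\<close>

definition selection_mat :: "nat \<Rightarrow> nat set \<Rightarrow> real mat \<Rightarrow> bool" where
  "selection_mat n K J \<longleftrightarrow> (\<exists>ks. distinct ks \<and> set ks = K \<and>
     J = mat (length ks) n (\<lambda>(r, c). if c = ks ! r then 1 else 0))"

definition vsum :: "nat \<Rightarrow> nat \<Rightarrow> (nat \<Rightarrow> real vec) \<Rightarrow> real vec" where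
  "vsum m k f = vec m (\<lambda>r. \<Sum>i<k. f i $ r)"

definition msum :: "nat \<Rightarrow> nat \<Rightarrow> (nat \<Rightarrow> real mat) \<Rightarrow> real mat" where
  "msum m k f = mat m m (\<lambda>rc. \<Sum>i<k. f i $$ rc)"

section \<open>Smooth functions of the state\<close>

text \<open>The type of vectors of varying dimension carries no topology.  A subset \<open>D\<close> of
  \<open>carrier_vec n\<close> and a function on it are therefore pulled back along \<open>vec n\<close> to
  \<open>nat \<Rightarrow> real\<close> with the product topology; as \<open>vec n\<close> only reads the first \<open>n\<close> coordinates,
  openness and continuity are those of n-dimensional Euclidean space.\<close>

definition coords :: "nat \<Rightarrow> real vec set \<Rightarrow> (nat \<Rightarrow> real) set" where
  "coords n D = {x. vec n x \<in> D}"

definition open_states :: "nat \<Rightarrow> real vec set \<Rightarrow> bool" where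
  "open_states n D \<longleftrightarrow> D \<subseteq> carrier_vec n \<and> open (coords n D)"

text \<open>All partial derivatives of order at most the first argument exist and are continuous.\<close>

primrec cont_diff :: "nat \<Rightarrow> nat \<Rightarrow> (nat \<Rightarrow> real) set \<Rightarrow> ((nat \<Rightarrow> real) \<Rightarrow> real) \<Rightarrow> bool" where
  "cont_diff 0 n D g = continuous_on D g"
| "cont_diff (Suc r) n D g = (continuous_on D g \<and>
     (\<forall>i<n. (\<forall>x\<in>D. (\<lambda>s. g (x(i := s))) differentiable (at (x i))) \<and>
            cont_diff r n D (\<lambda>x. deriv (\<lambda>s. g (x(i := s))) (x i))))"

definition smooth_mat_on :: "nat \<Rightarrow> real vec set \<Rightarrow> (real vec \<Rightarrow> real mat) \<Rightarrow> bool" where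
  "smooth_mat_on n D B \<longleftrightarrow>
     (\<forall>r. \<forall>p<n. \<forall>q<n. cont_diff r n (coords n D) (\<lambda>x. B (vec n x) $$ (p, q)))"

section \<open>The discretisation\<close>

text \<open>Coefficients of the boundary treatment: functions of the boundary node (and hence of its
  position and discrete normal), time, and the state of the solution in that node.\<close>

type_synonym 'a bcoef = "nat \<Rightarrow> real \<Rightarrow> real vec \<Rightarrow> 'a"

record sbp =
  nvar :: nat                               \<comment> \<open>number of components \<open>n\<close>\<close>
  ndim :: nat                               \<comment> \<open>space dimension \<open>k\<close>\<close>
  nnode :: nat                              \<comment> \<open>number of nodes \<open>M\<close>\<close>
  nbdry :: nat                              \<comment> \<open>number of boundary nodes \<open>N\<close>\<close>
  states :: "real vec set"                  \<comment> \<open>states for which the coefficients are defined\<close>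
  Pmat :: "real mat"
  Acoef :: "nat \<Rightarrow> real vec \<Rightarrow> real mat"
  Ccoef :: "real vec \<Rightarrow> real mat"
  pos :: "nat \<Rightarrow> real vec"                  \<comment> \<open>positions of the nodes\<close>
  bnode :: "nat \<Rightarrow> nat"                     \<comment> \<open>the node underlying a boundary node\<close>
  POmega :: "real mat"                      \<comment> \<open>volume quadrature\<close>
  Qmat :: "nat \<Rightarrow> real mat"
  ds :: "nat \<Rightarrow> real"                       \<comment> \<open>boundary quadrature weights\<close>
  normal :: "nat \<Rightarrow> real vec"               \<comment> \<open>discrete outward normal\<close>
  Tmat :: "real mat bcoef"
  lam :: "(nat \<Rightarrow> real) bcoef"              \<comment> \<open>the diagonal of \<open>\<Lambda>\<close>\<close>
  Jplus :: "real mat bcoef"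
  Jminus :: "real mat bcoef"
  Rmat :: "real mat bcoef"
  Smat :: "real mat bcoef"
  Sigmat :: "real mat bcoef"
  Finit :: "real vec \<Rightarrow> real vec"           \<comment> \<open>initial data, a function of position\<close>
  Gdata :: "real vec \<Rightarrow> real \<Rightarrow> real vec"   \<comment> \<open>boundary data, a function of position and time\<close>

definition Emat :: "sbp \<Rightarrow> real mat" where
  "Emat d = mat (nbdry d) (nnode d) (\<lambda>(j, m). if m = bnode d j then 1 else 0)"

definition Pbdry :: "sbp \<Rightarrow> real mat" where
  "Pbdry d = mat_diag (nbdry d) (ds d)"

definition Nmat :: "sbp \<Rightarrow> nat \<Rightarrow> real mat" where
  "Nmat d i = mat_diag (nbdry d) (\<lambda>j. normal d j $ i)"

definition sbp_scheme :: "sbp \<Rightarrow> bool" where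
  "sbp_scheme d \<longleftrightarrow>
     pos_semidef (Pmat d) \<and> Pmat d \<in> carrier_mat (nvar d) (nvar d) \<and>
     open_states (nvar d) (states d) \<and>
     (\<forall>i<ndim d. smooth_mat_on (nvar d) (states d) (Acoef d i) \<and>
        (\<forall>u\<in>states d. Acoef d i u \<in> carrier_mat (nvar d) (nvar d))) \<and>
     smooth_mat_on (nvar d) (states d) (Ccoef d) \<and>
     (\<forall>u\<in>states d. Ccoef d u \<in> carrier_mat (nvar d) (nvar d) \<and>
        Ccoef d u + (Ccoef d u)\<^sup>T = 0\<^sub>m (nvar d) (nvar d)) \<and>
     (\<forall>m<nnode d. pos d m \<in> carrier_vec (ndim d) \<and> Finit d (pos d m) \<in> carrier_vec (nvar d)) \<and>
     (\<forall>j<nbdry d. bnode d j < nnode d \<and> ds d j > 0 \<and> normal d j \<in> carrier_vec (ndim d)) \<and>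
     inj_on (bnode d) {..<nbdry d} \<and>
     POmega d \<in> carrier_mat (nnode d) (nnode d) \<and> diagonal_mat (POmega d) \<and> pos_def (POmega d) \<and>
     (\<forall>i<ndim d. Qmat d i \<in> carrier_mat (nnode d) (nnode d) \<and>
        Qmat d i + (Qmat d i)\<^sup>T = (Emat d)\<^sup>T * Pbdry d * Nmat d i * Emat d)"

text \<open>Grid functions have length \<open>n * M\<close> and are ordered by component first: entry \<open>p * M + m\<close> is
  component \<open>p\<close> in node \<open>m\<close>.\<close>

definition node_val :: "sbp \<Rightarrow> real vec \<Rightarrow> nat \<Rightarrow> real vec" where
  "node_val d U m = vec (nvar d) (\<lambda>p. U $ (p * nnode d + m))"

definition stack_nodes :: "sbp \<Rightarrow> (nat \<Rightarrow> real vec) \<Rightarrow> real vec" where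
  "stack_nodes d f = vec (nvar d * nnode d) (\<lambda>r. f (r mod nnode d) $ (r div nnode d))"

definition Fvec :: "sbp \<Rightarrow> real vec" where
  "Fvec d = stack_nodes d (\<lambda>m. Finit d (pos d m))"

text \<open>The block matrix whose \<open>(p, q)\<close> block is diagonal with the node values of entry \<open>(p, q)\<close>
  of \<open>B\<close>.\<close>

definition block_mat :: "sbp \<Rightarrow> (real vec \<Rightarrow> real mat) \<Rightarrow> real vec \<Rightarrow> real mat" where
  "block_mat d B U = mat (nvar d * nnode d) (nvar d * nnode d)
     (\<lambda>(r, c). if r mod nnode d = c mod nnode d
               then B (node_val d U (r mod nnode d)) $$ (r div nnode d, c div nnode d) else 0)"

definition Dx :: "sbp \<Rightarrow> nat \<Rightarrow> real mat" where
  "Dx d i = kron (1\<^sub>m (nvar d)) (minv (POmega d) * Qmat d i)"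

text \<open>Reorders boundary values from component-first to node-first.\<close>

definition Perm :: "sbp \<Rightarrow> real mat" where
  "Perm d = mat (nbdry d * nvar d) (nvar d * nbdry d)
     (\<lambda>(r, c). if c = (r mod nvar d) * nbdry d + r div nvar d then 1 else 0)"

definition bdry_val :: "sbp \<Rightarrow> real vec \<Rightarrow> nat \<Rightarrow> real vec" where
  "bdry_val d U j = vec (nvar d)
     (\<lambda>p. (Perm d *\<^sub>v (kron (1\<^sub>m (nvar d)) (Emat d) *\<^sub>v U)) $ (j * nvar d + p))"

text \<open>Evaluation of a boundary coefficient at the discrete solution.\<close>

definition at_bdry :: "sbp \<Rightarrow> 'a bcoef \<Rightarrow> real \<Rightarrow> real vec \<Rightarrow> nat \<Rightarrow> 'a" where
  "at_bdry d f t U j = f j t (bdry_val d U j)"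

subsection \<open>Rotated variables\<close>

definition Atilde :: "sbp \<Rightarrow> real vec \<Rightarrow> nat \<Rightarrow> real mat" where
  "Atilde d U j =
     (let B = msum (nvar d) (ndim d) (\<lambda>i. (normal d j $ i) \<cdot>\<^sub>m Acoef d i (bdry_val d U j))
      in (1/2) \<cdot>\<^sub>m (B + B\<^sup>T))"

definition Wvec :: "sbp \<Rightarrow> real \<Rightarrow> real vec \<Rightarrow> nat \<Rightarrow> real vec" where
  "Wvec d t U j = minv (at_bdry d (Tmat d) t U j) *\<^sub>v bdry_val d U j"

definition Lam :: "sbp \<Rightarrow> real \<Rightarrow> real vec \<Rightarrow> nat \<Rightarrow> real mat" where
  "Lam d t U j = mat_diag (nvar d) (at_bdry d (lam d) t U j)"

definition pos_idx :: "sbp \<Rightarrow> real \<Rightarrow> real vec \<Rightarrow> nat \<Rightarrow> nat set" where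
  "pos_idx d t U j = {i. i < nvar d \<and> at_bdry d (lam d) t U j i > 0}"

definition neg_idx :: "sbp \<Rightarrow> real \<Rightarrow> real vec \<Rightarrow> nat \<Rightarrow> nat set" where
  "neg_idx d t U j = {i. i < nvar d \<and> at_bdry d (lam d) t U j i < 0}"

definition Wplus :: "sbp \<Rightarrow> real \<Rightarrow> real vec \<Rightarrow> nat \<Rightarrow> real vec" where
  "Wplus d t U j = at_bdry d (Jplus d) t U j *\<^sub>v Wvec d t U j"

definition Wminus :: "sbp \<Rightarrow> real \<Rightarrow> real vec \<Rightarrow> nat \<Rightarrow> real vec" where
  "Wminus d t U j = at_bdry d (Jminus d) t U j *\<^sub>v Wvec d t U j"

definition Lam_plus :: "sbp \<Rightarrow> real \<Rightarrow> real vec \<Rightarrow> nat \<Rightarrow> real mat" where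
  "Lam_plus d t U j = at_bdry d (Jplus d) t U j * Lam d t U j * (at_bdry d (Jplus d) t U j)\<^sup>T"

definition Lam_minus :: "sbp \<Rightarrow> real \<Rightarrow> real vec \<Rightarrow> nat \<Rightarrow> real mat" where
  "Lam_minus d t U j = at_bdry d (Jminus d) t U j * Lam d t U j * (at_bdry d (Jminus d) t U j)\<^sup>T"

definition abs_Lam_minus :: "sbp \<Rightarrow> real \<Rightarrow> real vec \<Rightarrow> nat \<Rightarrow> real mat" where
  "abs_Lam_minus d t U j = map_mat abs (Lam_minus d t U j)"

definition sqrt_abs_Lam_minus :: "sbp \<Rightarrow> real \<Rightarrow> real vec \<Rightarrow> nat \<Rightarrow> real mat" where
  "sqrt_abs_Lam_minus d t U j = map_mat sqrt (abs_Lam_minus d t U j)"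

definition Gbdry :: "sbp \<Rightarrow> real \<Rightarrow> nat \<Rightarrow> real vec" where
  "Gbdry d t j = Gdata d (pos d (bnode d j)) t"

text \<open>The identity between the quadratic forms is required at the discrete solution only, not as
  a matrix identity, since \<open>\<Lambda>\<close> and \<open>T\<close> may themselves depend on the solution.\<close>

definition rotated_bdry :: "sbp \<Rightarrow> real \<Rightarrow> real vec \<Rightarrow> nat \<Rightarrow> bool" where
  "rotated_bdry d t U j \<longleftrightarrow>
     (let T = at_bdry d (Tmat d) t U j; R = at_bdry d (Rmat d) t U j; S = at_bdry d (Smat d) t U j;
          n_plus = card (pos_idx d t U j); n_minus = card (neg_idx d t U j); u = bdry_val d U j
      in T \<in> carrier_mat (nvar d) (nvar d) \<and> invertible_mat T \<and>
         u \<bullet> (Atilde d U j *\<^sub>v u) = Wvec d t U j \<bullet> (Lam d t U j *\<^sub>v Wvec d t U j) \<and>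
         selection_mat (nvar d) (pos_idx d t U j) (at_bdry d (Jplus d) t U j) \<and>
         selection_mat (nvar d) (neg_idx d t U j) (at_bdry d (Jminus d) t U j) \<and>
         R \<in> carrier_mat n_minus n_plus \<and>
         S \<in> carrier_mat n_minus n_minus \<and> invertible_mat S \<and>
         at_bdry d (Sigmat d) t U j \<in> carrier_mat n_minus n_minus \<and>
         Gbdry d t j \<in> carrier_vec n_minus)"

subsection \<open>The semi-discrete scheme\<close>

definition LC_node :: "sbp \<Rightarrow> real \<Rightarrow> real vec \<Rightarrow> nat \<Rightarrow> real vec" where
  "LC_node d t U j =
     2 \<cdot>\<^sub>v ((at_bdry d (Jminus d) t U j * minv (at_bdry d (Tmat d) t U j))\<^sup>T *\<^sub>v
            (at_bdry d (Sigmat d) t U j *\<^sub>v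
              (Wminus d t U j - at_bdry d (Rmat d) t U j *\<^sub>v Wplus d t U j
               - minv (at_bdry d (Smat d) t U j) *\<^sub>v Gbdry d t j)))"

definition LC :: "sbp \<Rightarrow> real \<Rightarrow> real vec \<Rightarrow> real vec" where
  "LC d t U = vec (nbdry d * nvar d) (\<lambda>r. LC_node d t U (r div nvar d) $ (r mod nvar d))"

definition DC :: "sbp \<Rightarrow> real mat" where
  "DC d = kron (1\<^sub>m (nvar d)) ((Emat d)\<^sup>T) * (Perm d)\<^sup>T * kron (Pbdry d) (1\<^sub>m (nvar d))"

definition LD :: "sbp \<Rightarrow> real \<Rightarrow> real vec \<Rightarrow> real vec" where
  "LD d t U = kron (1\<^sub>m (nvar d)) (minv (POmega d)) *\<^sub>v (DC d *\<^sub>v LC d t U)"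

text \<open>\<open>V\<close> is a solution on the time interval \<open>I\<close>, which starts at \<open>0\<close>; the derivative is one-sided
  at end points.\<close>

definition solution :: "sbp \<Rightarrow> real set \<Rightarrow> (real \<Rightarrow> real vec) \<Rightarrow> bool" where
  "solution d I V \<longleftrightarrow>
     is_interval I \<and> 0 \<in> I \<and> I \<subseteq> {0..} \<and> V 0 = Fvec d \<and>
     (\<forall>t\<in>I. V t \<in> carrier_vec (nvar d * nnode d) \<and>
        (\<forall>m<nnode d. node_val d (V t) m \<in> states d) \<and>
        (\<exists>Vt\<in>carrier_vec (nvar d * nnode d).
           (\<forall>r<nvar d * nnode d. ((\<lambda>s. V s $ r) has_real_derivative Vt $ r) (at t within I)) \<and>
           kron (Pmat d) (1\<^sub>m (nnode d)) *\<^sub>v Vt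
           + vsum (nvar d * nnode d) (ndim d)
               (\<lambda>i. Dx d i *\<^sub>v (block_mat d (Acoef d i) (V t) *\<^sub>v V t)
                    + (block_mat d (Acoef d i) (V t))\<^sup>T *\<^sub>v (Dx d i *\<^sub>v V t))
           + block_mat d (Ccoef d) (V t) *\<^sub>v V t
           + LD d t (V t) = 0\<^sub>v (nvar d * nnode d)))"

definition energy :: "sbp \<Rightarrow> real vec \<Rightarrow> real" where
  "energy d U = U \<bullet> (kron (Pmat d) (POmega d) *\<^sub>v U)"

definition bdry_data_sq :: "sbp \<Rightarrow> real \<Rightarrow> real" where
  "bdry_data_sq d t = (\<Sum>j<nbdry d. (Gbdry d t j \<bullet> Gbdry d t j) * ds d j)"

definition bdry_form :: "sbp \<Rightarrow> real \<Rightarrow> real vec \<Rightarrow> nat \<Rightarrow> real mat" where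
  "bdry_form d t U j =
     (let R = at_bdry d (Rmat d) t U j in Lam_plus d t U j - R\<^sup>T * abs_Lam_minus d t U j * R)"

end

theory Submission
  imports Defs "Jordan_Normal_Form.Determinant"
begin

text \<open>
  The result is an instance of the energy method.  Pairing the scheme with the solution in the
  inner product of the quadrature gives half the time derivative of the energy.  Because
  the advection terms are written in the split form \<open>D A U + A\<^sup>T D U\<close>, because the quadrature is diagonal
  and therefore commutes with the node-wise coefficient matrices, and because \<open>C\<close> is skew, all volume
  terms cancel, whatever the nonlinear dependence of the coefficients on the solution.
  What is left (\<open>energy_rate\<close>) is a weighted sum over the boundary nodes of the flux \<open>u\<^sup>T n\<^sub>i A\<^sub>i u\<close> and the penalty.

  At one boundary node the rotated variables diagonalise the flux.  With \<open>\<Sigma> = |\<Lambda>\<^sup>-|\<close> a completion of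
  the square (\<open>rotated_dissipation\<close>) writes flux plus penalty as
  \<open>(W\<^sup>+)\<^sup>T (\<Lambda>\<^sup>+ - R\<^sup>T |\<Lambda>\<^sup>-| R) W\<^sup>+ + |z|\<^sup>2 - 2 z\<^sup>T g - 2 (|\<Lambda>\<^sup>-|^{1/2} R W\<^sup>+)\<^sup>T g\<close>,
  where \<open>z\<close> is the weighted residual of the homogeneous boundary condition and \<open>g\<close> the weighted data.

  For zero data this is a sum of two nonnegative terms, so the energy does not grow.  For nonzero
  data \<open>g\<close> equals \<open>S\<^sub>0 G\<close> by the form of \<open>S\<close>.  Young's inequality (\<open>pos_def_young\<close>) absorbs both cross
  terms into the two squares at the cost of \<open>(1 + c) |g|\<^sup>2\<close>, where \<open>c\<close> depends on \<open>\<Lambda>\<^sup>+\<close>, \<open>\<Lambda>\<^sup>-\<close> and \<open>R\<close> only;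
  a small \<open>S\<^sub>0\<close> brings this below \<open>|G|\<^sup>2\<close>.  Integrating in time (\<open>energy_estimate\<close>) gives
  the estimates; the factor 2 in front of the data comes from differentiating the square.
\<close>

section \<open>Kronecker products, diagonal matrices and inverses\<close>

text \<open>Grid functions are stored as flat vectors whose index \<open>r\<close> encodes the pair
  \<open>(r div b, r mod b)\<close>.  Every passage between Kronecker products and sums over components and
  nodes is an instance of this reindexing.\<close>

lemma sum_div_mod:
  fixes f :: "nat \<Rightarrow> nat \<Rightarrow> 'a::comm_monoid_add"
  shows "(\<Sum>r<a * b. f (r div b) (r mod b)) = (\<Sum>p<a. \<Sum>m<b. f p m)"
proof -
  have "(\<Sum>r<a * b. f (r div b) (r mod b)) = (\<Sum>p<a. \<Sum>r\<in>{p * b..<p * b + b}. f (r div b) (r mod b))"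
    by (rule sum.nat_group[symmetric])
  also have "\<dots> = (\<Sum>p<a. \<Sum>m<b. f p m)"
  proof (rule sum.cong[OF refl])
    fix p
    have "(\<Sum>r\<in>{p * b..<p * b + b}. f (r div b) (r mod b)) =
        (\<Sum>m<b. f ((m + p * b) div b) ((m + p * b) mod b))"
      using sum.shift_bounds_nat_ivl[of "\<lambda>r. f (r div b) (r mod b)" 0 "p * b" b]
      by (simp add: lessThan_atLeast0 add.commute)
    also have "\<dots> = (\<Sum>m<b. f p m)"
      by (rule sum.cong) auto
    finally show "(\<Sum>r\<in>{p * b..<p * b + b}. f (r div b) (r mod b)) = (\<Sum>m<b. f p m)" .
  qed
  finally show ?thesis .
qed

lemma index_bound:
  "p < (a::nat) \<Longrightarrow> m < b \<Longrightarrow> p * b + m < a * b"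
  by (rule order.strict_trans2[of _ "Suc p * b"]) (simp, metis Suc_leI mult_le_mono1)

lemma adjoint_scalar_prod:
  fixes B :: "real mat"
  assumes "B \<in> carrier_mat r c" "x \<in> carrier_vec r" "y \<in> carrier_vec c"
  shows "x \<bullet> (B *\<^sub>v y) = (B\<^sup>T *\<^sub>v x) \<bullet> y"
  by (rule transpose_vec_mult_scalar[OF assms(1,3,2), symmetric])

lemma kron_carrier [simp, intro]:
  "A \<in> carrier_mat a b \<Longrightarrow> B \<in> carrier_mat c e \<Longrightarrow> kron A B \<in> carrier_mat (a * c) (b * e)"
  unfolding kron_def by auto

lemma kron_index:
  "A \<in> carrier_mat a b \<Longrightarrow> B \<in> carrier_mat c e \<Longrightarrow> i < a * c \<Longrightarrow> j < b * e \<Longrightarrow>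
   kron A B $$ (i, j) = A $$ (i div c, j div e) * B $$ (i mod c, j mod e)"
  unfolding kron_def by auto

lemma transpose_kron: "(kron A B)\<^sup>T = kron A\<^sup>T B\<^sup>T"
proof (rule eq_matI)
  fix i j assume "i < dim_row (kron A\<^sup>T B\<^sup>T)" "j < dim_col (kron A\<^sup>T B\<^sup>T)"
  then have ij: "i < dim_col A * dim_col B" "j < dim_row A * dim_row B"
    by (auto simp: kron_def)
  then have "0 < dim_col B" "0 < dim_row B" by (auto intro!: Nat.gr0I)
  then show "(kron A B)\<^sup>T $$ (i, j) = kron A\<^sup>T B\<^sup>T $$ (i, j)"
    using ij by (simp add: kron_def less_mult_imp_div_less)
qed (auto simp: kron_def)

lemma kron_mult:
  assumes A: "A \<in> carrier_mat a b" and B: "B \<in> carrier_mat b c"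
    and A': "A' \<in> carrier_mat a' b'" and B': "B' \<in> carrier_mat b' c'"
  shows "kron A A' * kron B B' = kron (A * B) (A' * B')"
proof (rule eq_matI)
  have AB: "A * B \<in> carrier_mat a c" "A' * B' \<in> carrier_mat a' c'"
    using assms by auto
  fix i j assume "i < dim_row (kron (A * B) (A' * B'))" "j < dim_col (kron (A * B) (A' * B'))"
  then have ij: "i < a * a'" "j < c * c'"
    using kron_carrier[OF AB] by auto
  then have pos: "0 < a'" "0 < c'" by (auto intro!: Nat.gr0I)
  have lt: "i div a' < a" "i mod a' < a'" "j div c' < c" "j mod c' < c'"
    using ij pos by (auto simp: less_mult_imp_div_less)
  have "(kron A A' * kron B B') $$ (i, j) =
      (\<Sum>r<b * b'. kron A A' $$ (i, r) * kron B B' $$ (r, j))"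
    using kron_carrier[OF A A'] kron_carrier[OF B B'] ij
    by (simp add: scalar_prod_def lessThan_atLeast0)
  also have "\<dots> = (\<Sum>r<b * b'. (A $$ (i div a', r div b') * B $$ (r div b', j div c')) *
      (A' $$ (i mod a', r mod b') * B' $$ (r mod b', j mod c')))"
    by (rule sum.cong) (simp_all add: kron_index[OF A A'] kron_index[OF B B'] ij)
  also have "\<dots> = (\<Sum>p<b. \<Sum>m<b'. (A $$ (i div a', p) * B $$ (p, j div c')) *
      (A' $$ (i mod a', m) * B' $$ (m, j mod c')))"
    by (rule sum_div_mod)
  also have "\<dots> = (A * B) $$ (i div a', j div c') * (A' * B') $$ (i mod a', j mod c')"
    using lt A B A' B' by (simp add: scalar_prod_def lessThan_atLeast0 sum_product)
  also have "\<dots> = kron (A * B) (A' * B') $$ (i, j)"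
    by (simp add: kron_index[OF AB] ij)
  finally show "(kron A A' * kron B B') $$ (i, j) = kron (A * B) (A' * B') $$ (i, j)" .
qed (use assms in \<open>auto simp: kron_def\<close>)

lemma kron_one: "kron (1\<^sub>m a) (1\<^sub>m b) = 1\<^sub>m (a * b)"
proof (rule eq_matI)
  fix i j assume "i < dim_row (1\<^sub>m (a * b))" "j < dim_col (1\<^sub>m (a * b))"
  then have ij: "i < a * b" "j < a * b" by auto
  then have pos: "0 < b" by (auto intro!: Nat.gr0I)
  have "(i div b = j div b \<and> i mod b = j mod b) \<longleftrightarrow> i = j"
    by (metis div_mult_mod_eq)
  then show "kron (1\<^sub>m a) (1\<^sub>m b) $$ (i, j) = 1\<^sub>m (a * b) $$ (i, j)"
    using ij pos by (auto simp: kron_def less_mult_imp_div_less)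
qed (auto simp: kron_def)

lemma kron_add_right:
  assumes "A \<in> carrier_mat a b" "B \<in> carrier_mat c e" "C \<in> carrier_mat c e"
  shows "kron A (B + C) = kron A B + kron A C"
proof (rule eq_matI)
  fix i j assume "i < dim_row (kron A B + kron A C)" "j < dim_col (kron A B + kron A C)"
  then have ij: "i < a * c" "j < b * e" using assms by (auto simp: kron_def)
  then have "0 < c" "0 < e" by (auto intro!: Nat.gr0I)
  then show "kron A (B + C) $$ (i, j) = (kron A B + kron A C) $$ (i, j)"
    using ij assms by (simp add: kron_def less_mult_imp_div_less algebra_simps)
qed (use assms in \<open>auto simp: kron_def\<close>)

lemma minv_inverts:
  assumes B: "B \<in> carrier_mat n n" and inv: "invertible_mat B"
  shows "minv B \<in> carrier_mat n n" "B * minv B = 1\<^sub>m n" "minv B * B = 1\<^sub>m n"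
proof -
  obtain B' where B': "B * B' = 1\<^sub>m n" "B' * B = 1\<^sub>m (dim_row B')"
    using inv B unfolding invertible_mat_def inverts_mat_def by auto
  have c: "B' \<in> carrier_mat n n"
    using arg_cong[OF B'(1), of dim_col] arg_cong[OF B'(2), of dim_col] B by auto
  have "B \<in> Units (ring_mat TYPE(real) n undefined)"
    using B B' c by (auto simp: Units_def ring_mat_def)
  then obtain X where X: "mat_inverse B = Some X"
    using mat_inverse(1)[OF B, of undefined] by (cases "mat_inverse B") auto
  from mat_inverse(2)[OF B X] X
  show "minv B \<in> carrier_mat n n" "B * minv B = 1\<^sub>m n" "minv B * B = 1\<^sub>m n"
    by (auto simp: minv_def)
qed

text \<open>A vector in the kernel of a matrix has zero quadratic form, so a definite matrix has
  trivial kernel.\<close>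

lemma pos_def_invertible:
  assumes B: "B \<in> carrier_mat n n" and pd: "pos_def B"
  shows "invertible_mat B"
proof -
  have "det B \<noteq> 0"
  proof
    assume "det B = 0"
    then obtain v where v: "v \<in> carrier_vec n" "v \<noteq> 0\<^sub>v n" "B *\<^sub>v v = 0\<^sub>v n"
      using det_0_iff_vec_prod_zero_field[OF B] by blast
    then have "0 < v \<bullet> (B *\<^sub>v v)" using pd B unfolding pos_def_def by auto
    then show False using v by simp
  qed
  then obtain B' where "B' \<in> carrier_mat n n" "B' * B = 1\<^sub>m n" "B * B' = 1\<^sub>m n"
    using det_non_zero_imp_unit[OF B, of undefined] unfolding Units_def ring_mat_def by auto
  then show ?thesis
    using B unfolding invertible_mat_def inverts_mat_def by auto
qed

lemma mult_mat_zero_vec: "A \<in> carrier_mat r c \<Longrightarrow> A *\<^sub>v 0\<^sub>v c = 0\<^sub>v r"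
  by (intro eq_vecI) auto

lemma kron_mult_vec_index:
  assumes A: "A \<in> carrier_mat a b" and B: "B \<in> carrier_mat c e" and x: "x \<in> carrier_vec (b * e)"
    and i: "i < a * c"
  shows "(kron A B *\<^sub>v x) $ i =
    (\<Sum>p<b. \<Sum>m<e. A $$ (i div c, p) * B $$ (i mod c, m) * x $ (p * e + m))"
proof -
  have "(kron A B *\<^sub>v x) $ i = (\<Sum>r<b * e. kron A B $$ (i, r) * x $ r)"
    using kron_carrier[OF A B] x i by (simp add: scalar_prod_def lessThan_atLeast0)
  also have "\<dots> = (\<Sum>r<b * e. A $$ (i div c, r div e) * B $$ (i mod c, r mod e) *
      x $ (r div e * e + r mod e))"
    by (rule sum.cong) (simp_all add: kron_index[OF A B] i)
  also have "\<dots> = (\<Sum>p<b. \<Sum>m<e. A $$ (i div c, p) * B $$ (i mod c, m) * x $ (p * e + m))"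
    by (rule sum_div_mod)
  finally show ?thesis .
qed

lemma scalar_prod_mat_diag:
  fixes x y :: "real vec"
  assumes "x \<in> carrier_vec k" "y \<in> carrier_vec k"
  shows "x \<bullet> (mat_diag k f *\<^sub>v y) = (\<Sum>i<k. f i * (x $ i * y $ i))"
proof -
  have "(mat_diag k f *\<^sub>v y) $ i = f i * y $ i" if i: "i < k" for i
  proof -
    have "(mat_diag k f *\<^sub>v y) $ i = (\<Sum>c<k. (if i = c then f c else 0) * y $ c)"
      using i assms(2) by (simp add: mat_diag_def scalar_prod_def lessThan_atLeast0)
    also have "\<dots> = (\<Sum>c<k. if i = c then f c * y $ c else 0)"
      by (rule sum.cong) auto
    finally show ?thesis using i by simp
  qed
  then show ?thesis
    using assms by (auto simp: scalar_prod_def lessThan_atLeast0 mat_diag_def intro!: sum.cong)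
qed

lemma kron_one_mat_diag: "kron (1\<^sub>m a) (mat_diag b f) = mat_diag (a * b) (\<lambda>r. f (r mod b))"
proof (rule eq_matI)
  fix i j assume "i < dim_row (mat_diag (a * b) (\<lambda>r. f (r mod b)))"
    "j < dim_col (mat_diag (a * b) (\<lambda>r. f (r mod b)))"
  then have ij: "i < a * b" "j < a * b" by (auto simp: mat_diag_def)
  then have pos: "0 < b" by (auto intro!: Nat.gr0I)
  have "(i div b = j div b \<and> i mod b = j mod b) \<longleftrightarrow> i = j"
    by (metis div_mult_mod_eq)
  then show "kron (1\<^sub>m a) (mat_diag b f) $$ (i, j) = mat_diag (a * b) (\<lambda>r. f (r mod b)) $$ (i, j)"
    using ij pos by (auto simp: kron_def mat_diag_def less_mult_imp_div_less)
qed (auto simp: kron_def mat_diag_def)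

lemma kron_mat_diag_one: "kron (mat_diag a f) (1\<^sub>m b) = mat_diag (a * b) (\<lambda>r. f (r div b))"
proof (rule eq_matI)
  fix i j assume "i < dim_row (mat_diag (a * b) (\<lambda>r. f (r div b)))"
    "j < dim_col (mat_diag (a * b) (\<lambda>r. f (r div b)))"
  then have ij: "i < a * b" "j < a * b" by (auto simp: mat_diag_def)
  then have pos: "0 < b" by (auto intro!: Nat.gr0I)
  have "(i div b = j div b \<and> i mod b = j mod b) \<longleftrightarrow> i = j"
    by (metis div_mult_mod_eq)
  then show "kron (mat_diag a f) (1\<^sub>m b) $$ (i, j) = mat_diag (a * b) (\<lambda>r. f (r div b)) $$ (i, j)"
    using ij pos by (auto simp: kron_def mat_diag_def less_mult_imp_div_less)
qed (auto simp: kron_def mat_diag_def)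

lemma transpose_mat_diag: "(mat_diag k f)\<^sup>T = mat_diag k f"
  by (rule eq_matI) (auto simp: mat_diag_def)

lemma vsum_carrier [simp]: "vsum k l f \<in> carrier_vec k"
  by (simp add: vsum_def)

lemma scalar_prod_vsum:
  assumes "x \<in> carrier_vec k" "\<And>i. i < l \<Longrightarrow> f i \<in> carrier_vec k"
  shows "x \<bullet> vsum k l f = (\<Sum>i<l. x \<bullet> f i)"
proof -
  have "x \<bullet> vsum k l f = (\<Sum>r<k. \<Sum>i<l. x $ r * f i $ r)"
    using assms(1) by (simp add: scalar_prod_def vsum_def lessThan_atLeast0 sum_distrib_left)
  also have "\<dots> = (\<Sum>i<l. \<Sum>r<k. x $ r * f i $ r)" by (rule sum.swap)
  also have "\<dots> = (\<Sum>i<l. x \<bullet> f i)"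
    using assms(2) by (intro sum.cong) (auto simp: scalar_prod_def lessThan_atLeast0 dest!: carrier_vecD)
  finally show ?thesis .
qed

section \<open>Quadratic forms\<close>

text \<open>The sum of the moduli of all entries is one such constant, by \<open>2 |x y| \<le> x\<^sup>2 + y\<^sup>2\<close>.\<close>

lemma quadratic_form_bounded:
  fixes K :: "real mat"
  assumes K: "K \<in> carrier_mat k k"
  shows "\<exists>c\<ge>0. \<forall>g\<in>carrier_vec k. g \<bullet> (K *\<^sub>v g) \<le> c * (g \<bullet> g)"
proof (intro exI conjI ballI)
  let ?c = "\<Sum>p<k. \<Sum>q<k. \<bar>K $$ (p, q)\<bar>"
  show "0 \<le> ?c" by (intro sum_nonneg) auto
  fix g :: "real vec" assume g: "g \<in> carrier_vec k"
  have sq: "g $ p * g $ p \<le> g \<bullet> g" if "p < k" for p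
    using member_le_sum[of p "{..<k}" "\<lambda>p. g $ p * g $ p"] that g
    by (simp add: scalar_prod_def lessThan_atLeast0)
  have "g \<bullet> (K *\<^sub>v g) = (\<Sum>p<k. \<Sum>q<k. K $$ (p, q) * (g $ p * g $ q))"
    using g K by (simp add: scalar_prod_def lessThan_atLeast0 sum_distrib_left mult_ac)
  also have "\<dots> \<le> (\<Sum>p<k. \<Sum>q<k. \<bar>K $$ (p, q)\<bar> * (g \<bullet> g))"
  proof (intro sum_mono)
    fix p q assume "p \<in> {..<k}" "q \<in> {..<k}"
    then have "g $ p * g $ p \<le> g \<bullet> g" "g $ q * g $ q \<le> g \<bullet> g" using sq by auto
    moreover have "2 * \<bar>g $ p * g $ q\<bar> \<le> g $ p * g $ p + g $ q * g $ q"
      using sum_squares_bound[of "\<bar>g $ p\<bar>" "\<bar>g $ q\<bar>"] by (simp add: abs_mult power2_eq_square)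
    ultimately have "\<bar>g $ p * g $ q\<bar> \<le> g \<bullet> g" by linarith
    then have "\<bar>K $$ (p, q)\<bar> * \<bar>g $ p * g $ q\<bar> \<le> \<bar>K $$ (p, q)\<bar> * (g \<bullet> g)"
      by (rule mult_left_mono) simp
    then show "K $$ (p, q) * (g $ p * g $ q) \<le> \<bar>K $$ (p, q)\<bar> * (g \<bullet> g)"
      by (metis abs_ge_self abs_mult order_trans)
  qed
  also have "\<dots> = ?c * (g \<bullet> g)" by (simp add: sum_distrib_right)
  finally show "g \<bullet> (K *\<^sub>v g) \<le> ?c * (g \<bullet> g)" .
qed

lemma scalar_prod_self_nonneg: "0 \<le> v \<bullet> (v :: real vec)"
  by (simp add: scalar_prod_def sum_nonneg)

lemma gram_scalar_prod:
  fixes B :: "real mat"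
  assumes B: "B \<in> carrier_mat r c" and x: "x \<in> carrier_vec c" "y \<in> carrier_vec c"
  shows "x \<bullet> ((B\<^sup>T * B) *\<^sub>v y) = (B *\<^sub>v x) \<bullet> (B *\<^sub>v y)"
proof -
  have BT: "B\<^sup>T \<in> carrier_mat c r" using B by simp
  have By: "B *\<^sub>v y \<in> carrier_vec r" using mult_mat_vec_carrier[OF B x(2)] .
  show ?thesis
    using assoc_mult_mat_vec[OF BT B x(2)] adjoint_scalar_prod[OF BT x(1) By] by simp
qed

lemma
  assumes B: "B \<in> carrier_mat r c"
  shows mat_norm_nonneg: "0 \<le> mat_norm B"
    and mat_norm_bound: "x \<in> carrier_vec c \<Longrightarrow> (B *\<^sub>v x) \<bullet> (B *\<^sub>v x) \<le> (mat_norm B)\<^sup>2 * (x \<bullet> x)"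
proof -
  let ?f = "\<lambda>v. (B *\<^sub>v v) \<bullet> (B *\<^sub>v v)"
  let ?S = "{sqrt (?f v) | v. v \<in> carrier_vec (dim_col B) \<and> v \<bullet> v \<le> 1}"
  have BT: "B\<^sup>T * B \<in> carrier_mat c c" using B by simp
  obtain K where K: "0 \<le> K" and bound: "\<And>v. v \<in> carrier_vec c \<Longrightarrow> ?f v \<le> K * (v \<bullet> v)"
    using quadratic_form_bounded[OF BT] gram_scalar_prod[OF B] by metis
  have bdd: "bdd_above ?S"
  proof (rule bdd_aboveI[of _ "sqrt K"])
    fix y assume "y \<in> ?S"
    then obtain v where v: "y = sqrt (?f v)" "v \<in> carrier_vec c" "v \<bullet> v \<le> 1" using B by auto
    have "?f v \<le> K" using bound[OF v(2)] mult_left_mono[OF v(3) K] by simp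
    then show "y \<le> sqrt K" using v(1) by simp
  qed
  have unit: "sqrt (?f v) \<le> mat_norm B" if "v \<in> carrier_vec c" "v \<bullet> v \<le> 1" for v
    unfolding mat_norm_def by (rule cSup_upper[OF _ bdd]) (use that B in auto)
  show "0 \<le> mat_norm B"
    using order_trans[OF _ unit[of "0\<^sub>v c"]] by (simp add: scalar_prod_self_nonneg)
  show "(B *\<^sub>v x) \<bullet> (B *\<^sub>v x) \<le> (mat_norm B)\<^sup>2 * (x \<bullet> x)" if x: "x \<in> carrier_vec c"
  proof (cases "x \<bullet> x = 0")
    case True
    then show ?thesis using bound[OF x] by simp
  next
    case False
    let ?l = "sqrt (x \<bullet> x)"
    have pos: "0 < x \<bullet> x" using False scalar_prod_self_nonneg[of x] by simp
    then have l: "0 < ?l" "?l * ?l = x \<bullet> x" by auto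
    let ?v = "(1 / ?l) \<cdot>\<^sub>v x"
    have v: "?v \<in> carrier_vec c" using x by simp
    have vv: "?v \<bullet> ?v = (1 / ?l) * ((1 / ?l) * (x \<bullet> x))" using x by simp
    have "?v \<bullet> ?v = 1" unfolding vv using l by (simp add: field_simps)
    then have n: "sqrt (?f ?v) \<le> mat_norm B" using unit[OF v] by simp
    have Bx: "B *\<^sub>v x \<in> carrier_vec r" using mult_mat_vec_carrier[OF B x] .
    have fv: "?f ?v = (1 / ?l) * ((1 / ?l) * ?f x)"
      unfolding mult_mat_vec[OF B x] using Bx by simp
    have "?f ?v = (sqrt (?f ?v))\<^sup>2" using scalar_prod_self_nonneg by simp
    also have "\<dots> \<le> (mat_norm B)\<^sup>2"
      by (rule power_mono[OF n]) (simp add: scalar_prod_self_nonneg)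
    finally have "?f ?v * (x \<bullet> x) \<le> (mat_norm B)\<^sup>2 * (x \<bullet> x)"
      using pos by (intro mult_right_mono) auto
    moreover have "?f ?v * (x \<bullet> x) = ?f x"
      unfolding fv using l by (simp add: field_simps)
    ultimately show ?thesis by simp
  qed
qed

text \<open>Young's inequality with respect to the inner product given by \<open>B\<close>.  The minimum over
  \<open>w\<close> of \<open>w \<bullet> B w - 2 w \<bullet> X\<^sup>T g\<close> is \<open>- g \<bullet> X B^{-1} X\<^sup>T g\<close>, attained at
  \<open>w = B^{-1} X\<^sup>T g\<close>, and a quadratic form in \<open>g\<close> is bounded by a multiple of \<open>g \<bullet> g\<close>.  Passing
  through the inverse avoids a smallest eigenvalue and thus any compactness argument.\<close>

lemma pos_def_young:
  assumes B: "B \<in> carrier_mat a a" and pd: "pos_def B" and X: "X \<in> carrier_mat b a"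
  shows "\<exists>c\<ge>0. \<forall>w\<in>carrier_vec a. \<forall>g\<in>carrier_vec b.
    2 * ((X *\<^sub>v w) \<bullet> g) \<le> w \<bullet> (B *\<^sub>v w) + c * (g \<bullet> g)"
proof -
  note inv = minv_inverts[OF B pos_def_invertible[OF B pd]]
  have XT: "X\<^sup>T \<in> carrier_mat a b" using X by simp
  have iX: "minv B * X\<^sup>T \<in> carrier_mat a b" using inv(1) XT by simp
  have K: "X * (minv B * X\<^sup>T) \<in> carrier_mat b b" using X iX by simp
  obtain c where c: "0 \<le> c" "\<And>g. g \<in> carrier_vec b \<Longrightarrow> g \<bullet> ((X * (minv B * X\<^sup>T)) *\<^sub>v g) \<le> c * (g \<bullet> g)"
    using quadratic_form_bounded[OF K] by blast
  have "2 * ((X *\<^sub>v w) \<bullet> g) \<le> w \<bullet> (B *\<^sub>v w) + c * (g \<bullet> g)"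
    if w: "w \<in> carrier_vec a" and g: "g \<in> carrier_vec b" for w g
  proof -
    \<comment> \<open>\<open>?v\<close> is the minimiser; the claim is the expansion of \<open>0 \<le> (w - ?v) \<bullet> B (w - ?v)\<close>.\<close>
    let ?y = "X\<^sup>T *\<^sub>v g"
    let ?v = "minv B *\<^sub>v ?y"
    have y: "?y \<in> carrier_vec a" using mult_mat_vec_carrier[OF XT g] .
    have v: "?v \<in> carrier_vec a" using mult_mat_vec_carrier[OF inv(1) y] .
    have Bv: "B *\<^sub>v ?v = ?y"
      using assoc_mult_mat_vec[OF B inv(1) y] inv(2) y by simp
    have Bw: "B *\<^sub>v w \<in> carrier_vec a" using mult_mat_vec_carrier[OF B w] .
    have wv: "w - ?v \<in> carrier_vec a" using w v by simp
    have "0 \<le> (w - ?v) \<bullet> (B *\<^sub>v (w - ?v))"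
    proof (cases "w - ?v = 0\<^sub>v a")
      case True
      then show ?thesis using B by simp
    next
      case False
      then show ?thesis using pd B wv unfolding pos_def_def by (auto intro: less_imp_le)
    qed
    also have "\<dots> = w \<bullet> (B *\<^sub>v w) - ?v \<bullet> (B *\<^sub>v w) - (w \<bullet> ?y - ?v \<bullet> ?y)"
      using mult_minus_distrib_mat_vec[OF B w v] Bv minus_scalar_prod_distrib[OF w v]
        scalar_prod_minus_distrib[OF wv Bw y] Bw y by simp
    also have "?v \<bullet> (B *\<^sub>v w) = w \<bullet> ?y"
    proof -
      have "?v \<bullet> (B *\<^sub>v w) = (B\<^sup>T *\<^sub>v ?v) \<bullet> w" by (rule adjoint_scalar_prod[OF B v w])
      also have "B\<^sup>T = B" using pd by (simp add: pos_def_def)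
      finally show ?thesis using Bv comm_scalar_prod[OF y w] by simp
    qed
    also have "w \<bullet> ?y = (X *\<^sub>v w) \<bullet> g"
      using adjoint_scalar_prod[OF XT w g] by simp
    also have "?v \<bullet> ?y = g \<bullet> ((X * (minv B * X\<^sup>T)) *\<^sub>v g)"
    proof -
      have Xv: "X *\<^sub>v ?v \<in> carrier_vec b" using mult_mat_vec_carrier[OF X v] .
      have "(X * (minv B * X\<^sup>T)) *\<^sub>v g = X *\<^sub>v ?v"
        using assoc_mult_mat_vec[OF X iX g] assoc_mult_mat_vec[OF inv(1) XT g] by simp
      moreover have "?v \<bullet> ?y = (X *\<^sub>v ?v) \<bullet> g" using adjoint_scalar_prod[OF XT v g] by simp
      ultimately show ?thesis using comm_scalar_prod[OF Xv g] by simp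
    qed
    finally show ?thesis using c(2)[OF g] by linarith
  qed
  then show ?thesis using c(1) by blast
qed

lemma square_expansion:
  fixes x y g :: "real vec"
  assumes "x \<in> carrier_vec k" "y \<in> carrier_vec k" "g \<in> carrier_vec k"
  shows "x \<bullet> (x - y - g) * 2 - x \<bullet> x =
    (x - y) \<bullet> (x - y) - 2 * ((x - y) \<bullet> g) - 2 * (y \<bullet> g) - y \<bullet> y"
proof -
  have [simp]: "dim_vec x = k" "dim_vec y = k" "dim_vec g = k" using assms by auto
  show ?thesis
    by (simp add: scalar_prod_def sum_distrib_left sum_distrib_right flip: sum_subtractf)
      (rule sum.cong, simp_all add: algebra_simps)
qed

text \<open>The algebra behind the choice \<open>\<Sigma> = |\<Lambda>\<^sup>-|\<close>, with \<open>s\<close> standing for \<open>|\<Lambda>\<^sup>-|^{1/2}\<close> and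
  \<open>h\<close> for \<open>S^{-1} G\<close>.  The left side is the flux plus the penalty.  The penalty contributes
  \<open>2 (W\<^sup>-)\<^sup>T |\<Lambda>\<^sup>-| W\<^sup>-\<close>, which turns the negative sign of the flux of \<open>W\<^sup>-\<close> into a
  positive one.  Completing the square in \<open>W\<^sup>-\<close> then leaves the form \<open>\<Lambda>\<^sup>+ - R\<^sup>T |\<Lambda>\<^sup>-| R\<close> in \<open>W\<^sup>+\<close>,
  the square of the weighted boundary residual \<open>z\<close>, and two cross terms with the data.\<close>

lemma boundary_completion:
  fixes Lp s R :: "real mat"
  assumes Lp: "Lp \<in> carrier_mat a a" and s: "s \<in> carrier_mat b b" and sym: "s\<^sup>T = s"
    and R: "R \<in> carrier_mat b a"
    and wp: "wp \<in> carrier_vec a" and wm: "wm \<in> carrier_vec b" and h: "h \<in> carrier_vec b"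
  defines "z \<equiv> s *\<^sub>v (wm - R *\<^sub>v wp)" and "g \<equiv> s *\<^sub>v h" and "y \<equiv> (s * R) *\<^sub>v wp"
  shows "wp \<bullet> (Lp *\<^sub>v wp) - wm \<bullet> ((s * s) *\<^sub>v wm) + 2 * (wm \<bullet> ((s * s) *\<^sub>v (wm - R *\<^sub>v wp - h))) =
    wp \<bullet> ((Lp - R\<^sup>T * (s * s) * R) *\<^sub>v wp) + z \<bullet> z - 2 * (z \<bullet> g) - 2 * (y \<bullet> g)"
proof -
  let ?x = "s *\<^sub>v wm"
  have Rwp: "R *\<^sub>v wp \<in> carrier_vec b" using mult_mat_vec_carrier[OF R wp] .
  have d: "wm - R *\<^sub>v wp \<in> carrier_vec b" and dh: "wm - R *\<^sub>v wp - h \<in> carrier_vec b"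
    using wm Rwp h by auto
  have sR: "s * R \<in> carrier_mat b a" using s R by simp
  have y: "y = s *\<^sub>v (R *\<^sub>v wp)" unfolding y_def by (rule assoc_mult_mat_vec[OF s R wp])
  have c: "?x \<in> carrier_vec b" "y \<in> carrier_vec b" "g \<in> carrier_vec b"
    using mult_mat_vec_carrier[OF s] wm Rwp h unfolding y g_def by auto
  have z: "z = ?x - y" unfolding z_def y by (rule mult_minus_distrib_mat_vec[OF s wm Rwp])
  have zg: "s *\<^sub>v (wm - R *\<^sub>v wp - h) = ?x - y - g"
    using mult_minus_distrib_mat_vec[OF s d h] z unfolding z_def g_def by simp
  have gram: "v \<bullet> ((s * s) *\<^sub>v v') = (s *\<^sub>v v) \<bullet> (s *\<^sub>v v')"
    if "v \<in> carrier_vec b" "v' \<in> carrier_vec b" for v v'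
    using gram_scalar_prod[OF s that] sym by simp
  have RT: "R\<^sup>T \<in> carrier_mat a b" using R by simp
  have sT: "(s * R)\<^sup>T = R\<^sup>T * s" using transpose_mult[OF s R] sym by simp
  have RsR: "R\<^sup>T * (s * s) * R = (s * R)\<^sup>T * (s * R)"
    unfolding sT assoc_mult_mat[OF RT s s, symmetric]
    by (rule assoc_mult_mat[OF mult_carrier_mat[OF RT s] s R])
  have RsRc: "R\<^sup>T * (s * s) * R \<in> carrier_mat a a"
    unfolding RsR using sR by simp
  have "wp \<bullet> ((R\<^sup>T * (s * s) * R) *\<^sub>v wp) = y \<bullet> y"
    unfolding RsR y_def by (rule gram_scalar_prod[OF sR wp wp])
  moreover have "wp \<bullet> ((Lp - R\<^sup>T * (s * s) * R) *\<^sub>v wp) =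
      wp \<bullet> (Lp *\<^sub>v wp) - wp \<bullet> ((R\<^sup>T * (s * s) * R) *\<^sub>v wp)"
    unfolding minus_mult_distrib_mat_vec[OF Lp RsRc wp]
    by (rule scalar_prod_minus_distrib[OF wp])
      (rule mult_mat_vec_carrier[OF Lp wp] mult_mat_vec_carrier[OF RsRc wp])+
  moreover note square_expansion[OF c]
  ultimately show ?thesis
    unfolding gram[OF wm wm] gram[OF wm dh] zg z by linarith
qed

lemma square_minus_ge:
  fixes z g :: "real vec"
  assumes "z \<in> carrier_vec k" "g \<in> carrier_vec k"
  shows "- (g \<bullet> g) \<le> z \<bullet> z - 2 * (z \<bullet> g)"
proof -
  have "0 \<le> (z - g) \<bullet> (z - g)" by (rule scalar_prod_self_nonneg)
  also have "\<dots> = z \<bullet> z - 2 * (z \<bullet> g) + g \<bullet> g"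
    using assms comm_scalar_prod[OF assms]
    by (simp add: minus_scalar_prod_distrib[of _ k] scalar_prod_minus_distrib[of _ k])
  finally show ?thesis by simp
qed

section \<open>Grid functions and summation by parts\<close>

lemma block_mat_carrier [simp]:
  "block_mat d B U \<in> carrier_mat (nvar d * nnode d) (nvar d * nnode d)"
  by (simp add: block_mat_def)

lemma node_val_carrier [simp]: "node_val d U m \<in> carrier_vec (nvar d)"
  by (simp add: node_val_def)

lemma Emat_carrier [simp]: "Emat d \<in> carrier_mat (nbdry d) (nnode d)"
  by (simp add: Emat_def)

lemma Perm_carrier [simp]: "Perm d \<in> carrier_mat (nbdry d * nvar d) (nvar d * nbdry d)"
  by (simp add: Perm_def)

text \<open>\<open>I \<otimes> E\<close> picks, within each component, the entries of the boundary nodes.\<close>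

lemma restriction_index:
  assumes U: "U \<in> carrier_vec (nvar d * nnode d)" and p: "p < nvar d" and j: "j < nbdry d"
    and b: "bnode d j < nnode d"
  shows "(kron (1\<^sub>m (nvar d)) (Emat d) *\<^sub>v U) $ (p * nbdry d + j) = U $ (p * nnode d + bnode d j)"
proof -
  have "(kron (1\<^sub>m (nvar d)) (Emat d) *\<^sub>v U) $ (p * nbdry d + j) =
      (\<Sum>q<nvar d. \<Sum>m<nnode d. 1\<^sub>m (nvar d) $$ ((p * nbdry d + j) div nbdry d, q) *
        Emat d $$ ((p * nbdry d + j) mod nbdry d, m) * U $ (q * nnode d + m))"
    by (rule kron_mult_vec_index[OF one_carrier_mat Emat_carrier U index_bound[OF p j]])
  also have "\<dots> = (\<Sum>q<nvar d. \<Sum>m<nnode d. if m = bnode d j then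
      (if q = p then U $ (q * nnode d + m) else 0) else 0)"
    using p j by (intro sum.cong) (auto simp: Emat_def)
  also have "\<dots> = U $ (p * nnode d + bnode d j)"
    using b p by simp
  finally show ?thesis .
qed

lemma bdry_val_eq_node_val:
  assumes U: "U \<in> carrier_vec (nvar d * nnode d)" and j: "j < nbdry d" and b: "bnode d j < nnode d"
  shows "bdry_val d U j = node_val d U (bnode d j)"
proof (rule eq_vecI)
  fix p assume "p < dim_vec (node_val d U (bnode d j))"
  then have p: "p < nvar d" by (simp add: node_val_def)
  let ?Y = "kron (1\<^sub>m (nvar d)) (Emat d) *\<^sub>v U"
  have Y: "?Y \<in> carrier_vec (nvar d * nbdry d)"
    using mult_mat_vec_carrier[OF kron_carrier[OF one_carrier_mat Emat_carrier] U] .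
  have "(Perm d *\<^sub>v ?Y) $ (j * nvar d + p) =
      (\<Sum>c<nvar d * nbdry d. (if c = p * nbdry d + j then 1 else 0) * ?Y $ c)"
    using index_bound[OF j p] p Y carrier_vecD[OF Y]
    by (simp add: Perm_def scalar_prod_def lessThan_atLeast0)
  also have "\<dots> = (\<Sum>c<nvar d * nbdry d. if c = p * nbdry d + j then ?Y $ c else 0)"
    by (rule sum.cong) auto
  also have "\<dots> = ?Y $ (p * nbdry d + j)"
    using index_bound[OF p j] by simp
  finally show "bdry_val d U j $ p = node_val d U (bnode d j) $ p"
    using p restriction_index[OF U p j b] by (simp add: bdry_val_def node_val_def)
qed (simp add: bdry_val_def node_val_def)

lemma node_val_block_mat:
  assumes U: "U \<in> carrier_vec (nvar d * nnode d)" and X: "X \<in> carrier_vec (nvar d * nnode d)"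
    and m: "m < nnode d" and B: "B (node_val d U m) \<in> carrier_mat (nvar d) (nvar d)"
  shows "node_val d (block_mat d B U *\<^sub>v X) m = B (node_val d U m) *\<^sub>v node_val d X m"
proof (rule eq_vecI)
  let ?n = "nvar d" and ?M = "nnode d"
  fix p assume "p < dim_vec (B (node_val d U m) *\<^sub>v node_val d X m)"
  then have p: "p < ?n" using B by auto
  note r = index_bound[OF p m]
  have "(block_mat d B U *\<^sub>v X) $ (p * ?M + m) =
      (\<Sum>c<?n * ?M. block_mat d B U $$ (p * ?M + m, c) * X $ c)"
    using r X by (simp add: block_mat_def scalar_prod_def lessThan_atLeast0)
  also have "\<dots> = (\<Sum>c<?n * ?M. (if m = c mod ?M then B (node_val d U m) $$ (p, c div ?M) else 0) *
      X $ (c div ?M * ?M + c mod ?M))"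
    using r m by (intro sum.cong) (auto simp: block_mat_def)
  also have "\<dots> = (\<Sum>q<?n. \<Sum>l<?M. (if m = l then B (node_val d U m) $$ (p, q) else 0) *
      X $ (q * ?M + l))"
    by (rule sum_div_mod)
  also have "\<dots> = (\<Sum>q<?n. \<Sum>l<?M. if l = m then B (node_val d U m) $$ (p, q) * X $ (q * ?M + l) else 0)"
    by (intro sum.cong) auto
  also have "\<dots> = (\<Sum>q<?n. B (node_val d U m) $$ (p, q) * X $ (q * ?M + m))"
    using m by simp
  also have "\<dots> = (B (node_val d U m) *\<^sub>v node_val d X m) $ p"
    using p B by (simp add: scalar_prod_def lessThan_atLeast0 node_val_def)
  finally show "node_val d (block_mat d B U *\<^sub>v X) m $ p = (B (node_val d U m) *\<^sub>v node_val d X m) $ p"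
    using p by (simp add: node_val_def)
qed (use B in \<open>simp add: node_val_def\<close>)

text \<open>The blocks of \<open>block_mat\<close> are diagonal, so they act node by node and commute with weights
  that depend on the node only.  This is where the diagonal volume quadrature matters.\<close>

lemma weight_commutes_block_mat:
  "kron (1\<^sub>m (nvar d)) (mat_diag (nnode d) w) * block_mat d B U =
   block_mat d B U * kron (1\<^sub>m (nvar d)) (mat_diag (nnode d) w)"
  unfolding kron_one_mat_diag mat_diag_mult_left[OF block_mat_carrier]
    mat_diag_mult_right[OF block_mat_carrier]
  by (rule eq_matI) (auto simp: block_mat_def)

lemma block_mat_skew:
  assumes U: "\<And>m. m < nnode d \<Longrightarrow> B (node_val d U m) \<in> carrier_mat (nvar d) (nvar d) \<and>
      B (node_val d U m) + (B (node_val d U m))\<^sup>T = 0\<^sub>m (nvar d) (nvar d)"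
  shows "(block_mat d B U)\<^sup>T = - block_mat d B U"
proof (rule eq_matI)
  let ?n = "nvar d" and ?M = "nnode d"
  fix i j assume "i < dim_row (- block_mat d B U)" "j < dim_col (- block_mat d B U)"
  then have ij: "i < ?n * ?M" "j < ?n * ?M" by (auto simp: block_mat_def)
  then have "0 < ?M" by (auto intro!: Nat.gr0I)
  then have m: "i mod ?M < ?M" and dv: "i div ?M < ?n" "j div ?M < ?n"
    using ij by (auto simp: less_mult_imp_div_less)
  let ?B = "B (node_val d U (i mod ?M))"
  have B: "?B \<in> carrier_mat ?n ?n" and z: "?B + ?B\<^sup>T = 0\<^sub>m ?n ?n" using U[OF m] by auto
  have "(?B + ?B\<^sup>T) $$ (i div ?M, j div ?M) = 0" using dv by (simp add: z)
  then have "?B $$ (i div ?M, j div ?M) + ?B $$ (j div ?M, i div ?M) = 0"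
    using dv B by simp
  then show "(block_mat d B U)\<^sup>T $$ (i, j) = (- block_mat d B U) $$ (i, j)"
    using ij by (auto simp: block_mat_def)
qed (auto simp: block_mat_def)

lemma LC_carrier [simp]: "LC d t U \<in> carrier_vec (nbdry d * nvar d)"
  by (simp add: LC_def)

lemma bdry_val_carrier [simp]: "bdry_val d U j \<in> carrier_vec (nvar d)"
  by (simp add: bdry_val_def)

text \<open>\<open>DC\<close> is the transpose of the map from a grid function to its weighted, node-ordered boundary
  values; moving its factors to the left turns the pairing into a boundary quadrature.\<close>

lemma scalar_prod_lifting:
  assumes U: "U \<in> carrier_vec (nvar d * nnode d)"
    and L: "\<And>j. j < nbdry d \<Longrightarrow> LC_node d t U j \<in> carrier_vec (nvar d)"
  shows "U \<bullet> (DC d *\<^sub>v LC d t U) = (\<Sum>j<nbdry d. ds d j * (bdry_val d U j \<bullet> LC_node d t U j))"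
proof -
  let ?n = "nvar d" and ?M = "nnode d" and ?N = "nbdry d"
  let ?E = "kron (1\<^sub>m ?n) (Emat d)" and ?K = "kron (Pbdry d) (1\<^sub>m ?n)"
  have E: "?E \<in> carrier_mat (?n * ?N) (?n * ?M)" by simp
  have K: "?K \<in> carrier_mat (?N * ?n) (?N * ?n)" by (simp add: Pbdry_def)
  have Kd: "?K = mat_diag (?N * ?n) (\<lambda>r. ds d (r div ?n))"
    unfolding Pbdry_def by (rule kron_mat_diag_one)
  have DC: "DC d = ?E\<^sup>T * (Perm d)\<^sup>T * ?K"
    unfolding DC_def by (simp add: transpose_kron)
  have EU: "?E *\<^sub>v U \<in> carrier_vec (?n * ?N)" using mult_mat_vec_carrier[OF E U] .
  let ?Z = "Perm d *\<^sub>v (?E *\<^sub>v U)"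
  have Z: "?Z \<in> carrier_vec (?N * ?n)" using mult_mat_vec_carrier[OF Perm_carrier EU] .
  have KL: "?K *\<^sub>v LC d t U \<in> carrier_vec (?N * ?n)" using mult_mat_vec_carrier[OF K LC_carrier] .
  have ET: "?E\<^sup>T \<in> carrier_mat (?n * ?M) (?n * ?N)" and PT: "(Perm d)\<^sup>T \<in> carrier_mat (?n * ?N) (?N * ?n)"
    using E by auto
  have PK: "(Perm d)\<^sup>T *\<^sub>v (?K *\<^sub>v LC d t U) \<in> carrier_vec (?n * ?N)"
    using mult_mat_vec_carrier[OF PT KL] .
  have "DC d *\<^sub>v LC d t U = ?E\<^sup>T *\<^sub>v ((Perm d)\<^sup>T *\<^sub>v (?K *\<^sub>v LC d t U))"
    unfolding DC using assoc_mult_mat_vec[OF mult_carrier_mat[OF ET PT] K LC_carrier]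
      assoc_mult_mat_vec[OF ET PT KL] by simp
  then have "U \<bullet> (DC d *\<^sub>v LC d t U) = ?Z \<bullet> (?K *\<^sub>v LC d t U)"
    using adjoint_scalar_prod[OF ET U PK] adjoint_scalar_prod[OF PT EU KL] by simp
  also have "\<dots> = (\<Sum>r<?N * ?n. ds d (r div ?n) * (?Z $ r * LC d t U $ r))"
    unfolding Kd by (rule scalar_prod_mat_diag[OF Z LC_carrier])
  also have "\<dots> = (\<Sum>r<?N * ?n. ds d (r div ?n) * (?Z $ (r div ?n * ?n + r mod ?n) *
      LC_node d t U (r div ?n) $ (r mod ?n)))"
    by (rule sum.cong) (simp_all add: LC_def)
  also have "\<dots> = (\<Sum>j<?N. \<Sum>p<?n. ds d j * (?Z $ (j * ?n + p) * LC_node d t U j $ p))"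
    by (rule sum_div_mod)
  also have "\<dots> = (\<Sum>j<?N. ds d j * (bdry_val d U j \<bullet> LC_node d t U j))"
    by (intro sum.cong refl)
      (simp add: bdry_val_def scalar_prod_def lessThan_atLeast0 sum_distrib_left carrier_vecD[OF L])
  finally show ?thesis .
qed

text \<open>Summation by parts, bilinear in \<open>U\<close> and \<open>Y\<close>.  The left side is \<open>U \<bullet> (I \<otimes> (Q + Q\<^sup>T)) Y\<close>,
  and the matrix factors through the restriction to the boundary.\<close>

lemma scalar_prod_sbp:
  assumes U: "U \<in> carrier_vec (nvar d * nnode d)" and Y: "Y \<in> carrier_vec (nvar d * nnode d)"
    and b: "\<And>j. j < nbdry d \<Longrightarrow> bnode d j < nnode d"
    and Q: "Q \<in> carrier_mat (nnode d) (nnode d)"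
    and sbp: "Q + Q\<^sup>T = (Emat d)\<^sup>T * Pbdry d * Nmat d i * Emat d"
  shows "U \<bullet> (kron (1\<^sub>m (nvar d)) Q *\<^sub>v Y) + Y \<bullet> (kron (1\<^sub>m (nvar d)) Q *\<^sub>v U) =
    (\<Sum>j<nbdry d. ds d j * (normal d j $ i * (node_val d U (bnode d j) \<bullet> node_val d Y (bnode d j))))"
proof -
  let ?n = "nvar d" and ?M = "nnode d" and ?N = "nbdry d"
  let ?K = "kron (1\<^sub>m ?n) Q" and ?E = "kron (1\<^sub>m ?n) (Emat d)"
  let ?w = "\<lambda>j. ds d j * normal d j $ i"
  let ?D = "kron (1\<^sub>m ?n) (mat_diag ?N ?w)"
  have K: "?K \<in> carrier_mat (?n * ?M) (?n * ?M)" using Q by simp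
  have KT: "?K\<^sup>T \<in> carrier_mat (?n * ?M) (?n * ?M)" using K by simp
  have E: "?E \<in> carrier_mat (?n * ?N) (?n * ?M)" by simp
  have ET: "?E\<^sup>T \<in> carrier_mat (?n * ?M) (?n * ?N)" using E by simp
  have D: "?D \<in> carrier_mat (?n * ?N) (?n * ?N)" by simp
  have ETm: "(Emat d)\<^sup>T \<in> carrier_mat ?M ?N" by simp
  have "(Emat d)\<^sup>T * Pbdry d * Nmat d i * Emat d = (Emat d)\<^sup>T * mat_diag ?N ?w * Emat d"
    unfolding Pbdry_def Nmat_def using assoc_mult_mat[OF ETm mat_diag_dim mat_diag_dim]
    by (simp del: assoc_mult_mat)
  then have "?K + ?K\<^sup>T = kron (1\<^sub>m ?n) ((Emat d)\<^sup>T * mat_diag ?N ?w * Emat d)"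
    using kron_add_right[OF one_carrier_mat Q, of "Q\<^sup>T" ?n] Q sbp by (simp add: transpose_kron)
  also have "\<dots> = ?E\<^sup>T * ?D * ?E"
    using kron_mult[OF one_carrier_mat one_carrier_mat mult_carrier_mat[OF ETm mat_diag_dim] Emat_carrier]
      kron_mult[OF one_carrier_mat one_carrier_mat ETm mat_diag_dim]
    by (simp add: transpose_kron)
  finally have S: "?K + ?K\<^sup>T = ?E\<^sup>T * ?D * ?E" .
  have EU: "?E *\<^sub>v U \<in> carrier_vec (?n * ?N)" and EY: "?E *\<^sub>v Y \<in> carrier_vec (?n * ?N)"
    using E U Y by (meson mult_mat_vec_carrier)+
  have DEY: "?D *\<^sub>v (?E *\<^sub>v Y) \<in> carrier_vec (?n * ?N)" using mult_mat_vec_carrier[OF D EY] .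
  have KY: "?K *\<^sub>v Y \<in> carrier_vec (?n * ?M)" "?K\<^sup>T *\<^sub>v Y \<in> carrier_vec (?n * ?M)"
    using mult_mat_vec_carrier[OF K Y] mult_mat_vec_carrier[OF KT Y] .
  have "Y \<bullet> (?K *\<^sub>v U) = U \<bullet> (?K\<^sup>T *\<^sub>v Y)"
    using adjoint_scalar_prod[OF K Y U] comm_scalar_prod[OF KY(2) U] by simp
  then have "U \<bullet> (?K *\<^sub>v Y) + Y \<bullet> (?K *\<^sub>v U) = U \<bullet> ((?K + ?K\<^sup>T) *\<^sub>v Y)"
    using add_mult_distrib_mat_vec[OF K KT Y] scalar_prod_add_distrib[OF U KY] by simp
  also have "\<dots> = U \<bullet> (?E\<^sup>T *\<^sub>v (?D *\<^sub>v (?E *\<^sub>v Y)))"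
    unfolding S using assoc_mult_mat_vec[OF mult_carrier_mat[OF ET D] E Y]
      assoc_mult_mat_vec[OF ET D EY] by simp
  also have "\<dots> = (?E *\<^sub>v U) \<bullet> (?D *\<^sub>v (?E *\<^sub>v Y))"
    using adjoint_scalar_prod[OF ET U DEY] by simp
  also have "\<dots> = (\<Sum>r<?n * ?N. ?w (r mod ?N) * ((?E *\<^sub>v U) $ r * (?E *\<^sub>v Y) $ r))"
    unfolding kron_one_mat_diag by (rule scalar_prod_mat_diag[OF EU EY])
  also have "\<dots> = (\<Sum>r<?n * ?N. ?w (r mod ?N) * ((?E *\<^sub>v U) $ (r div ?N * ?N + r mod ?N) *
      (?E *\<^sub>v Y) $ (r div ?N * ?N + r mod ?N)))"
    by (rule sum.cong) simp_all
  also have "\<dots> = (\<Sum>p<?n. \<Sum>j<?N. ?w j * ((?E *\<^sub>v U) $ (p * ?N + j) * (?E *\<^sub>v Y) $ (p * ?N + j)))"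
    by (rule sum_div_mod)
  also have "\<dots> = (\<Sum>p<?n. \<Sum>j<?N. ?w j * (node_val d U (bnode d j) $ p * node_val d Y (bnode d j) $ p))"
    using b by (intro sum.cong refl) (simp add: restriction_index U Y node_val_def)
  also have "\<dots> = (\<Sum>j<?N. \<Sum>p<?n. ?w j * (node_val d U (bnode d j) $ p * node_val d Y (bnode d j) $ p))"
    by (rule sum.swap)
  also have "\<dots> = (\<Sum>j<?N. ds d j * (normal d j $ i * (node_val d U (bnode d j) \<bullet> node_val d Y (bnode d j))))"
    by (intro sum.cong refl)
      (simp add: scalar_prod_def lessThan_atLeast0 sum_distrib_left mult.assoc node_val_def)
  finally show ?thesis .
qed

lemma smult_mat_mult_vec:
  fixes A :: "real mat"
  assumes "A \<in> carrier_mat a b" "v \<in> carrier_vec b"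
  shows "(k \<cdot>\<^sub>m A) *\<^sub>v v = k \<cdot>\<^sub>v (A *\<^sub>v v)"
  using assms by (intro eq_vecI) (auto simp: scalar_prod_def sum_distrib_left mult.assoc)

lemma scalar_prod_msum:
  assumes u: "u \<in> carrier_vec k" "v \<in> carrier_vec k" and B: "\<And>i. i < l \<Longrightarrow> B i \<in> carrier_mat k k"
  shows "u \<bullet> (msum k l (\<lambda>i. c i \<cdot>\<^sub>m B i) *\<^sub>v v) = (\<Sum>i<l. c i * (u \<bullet> (B i *\<^sub>v v)))"
proof -
  have entry: "(c i \<cdot>\<^sub>m B i) $$ (p, q) = c i * B i $$ (p, q)" if "i < l" "p < k" "q < k" for i p q
    using B[OF that(1)] that by simp
  have form: "u \<bullet> (B i *\<^sub>v v) = (\<Sum>p<k. \<Sum>q<k. u $ p * (B i $$ (p, q) * v $ q))" if "i < l" for i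
    using u B[OF that] by (simp add: scalar_prod_def lessThan_atLeast0 sum_distrib_left)
  have "u \<bullet> (msum k l (\<lambda>i. c i \<cdot>\<^sub>m B i) *\<^sub>v v) =
      (\<Sum>p<k. \<Sum>q<k. \<Sum>i<l. c i * (u $ p * (B i $$ (p, q) * v $ q)))"
    using u by (auto simp: entry scalar_prod_def msum_def lessThan_atLeast0 sum_distrib_left sum_distrib_right
        mult_ac intro!: sum.cong dest!: carrier_matD)
  also have "\<dots> = (\<Sum>p<k. \<Sum>i<l. \<Sum>q<k. c i * (u $ p * (B i $$ (p, q) * v $ q)))"
    by (intro sum.cong refl sum.swap)
  also have "\<dots> = (\<Sum>i<l. \<Sum>p<k. \<Sum>q<k. c i * (u $ p * (B i $$ (p, q) * v $ q)))"
    by (rule sum.swap)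
  also have "\<dots> = (\<Sum>i<l. c i * (u \<bullet> (B i *\<^sub>v v)))"
    by (intro sum.cong refl) (simp add: form sum_distrib_left)
  finally show ?thesis .
qed

text \<open>A quadratic form only sees the symmetric part of its matrix.\<close>

lemma scalar_prod_Atilde:
  assumes A: "\<And>i. i < ndim d \<Longrightarrow> Acoef d i (bdry_val d U j) \<in> carrier_mat (nvar d) (nvar d)"
  shows "bdry_val d U j \<bullet> (Atilde d U j *\<^sub>v bdry_val d U j) =
    (\<Sum>i<ndim d. normal d j $ i * (bdry_val d U j \<bullet> (Acoef d i (bdry_val d U j) *\<^sub>v bdry_val d U j)))"
proof -
  let ?n = "nvar d" and ?u = "bdry_val d U j"
  let ?B = "msum ?n (ndim d) (\<lambda>i. (normal d j $ i) \<cdot>\<^sub>m Acoef d i ?u)"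
  have u: "?u \<in> carrier_vec ?n" by simp
  have B: "?B \<in> carrier_mat ?n ?n" "?B\<^sup>T \<in> carrier_mat ?n ?n" by (auto simp: msum_def)
  have Bu: "?B *\<^sub>v ?u \<in> carrier_vec ?n" "?B\<^sup>T *\<^sub>v ?u \<in> carrier_vec ?n"
    using mult_mat_vec_carrier[OF B(1) u] mult_mat_vec_carrier[OF B(2) u] .
  have smult: "((1/2) \<cdot>\<^sub>m (?B + ?B\<^sup>T)) *\<^sub>v ?u = (1/2) \<cdot>\<^sub>v ((?B + ?B\<^sup>T) *\<^sub>v ?u)"
    using smult_mat_mult_vec[of "?B + ?B\<^sup>T" ?n ?n ?u] B u by simp
  have "?u \<bullet> (Atilde d U j *\<^sub>v ?u) = (1/2) * (?u \<bullet> ((?B + ?B\<^sup>T) *\<^sub>v ?u))"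
    unfolding Atilde_def Let_def smult using B Bu u by (simp add: add_mult_distrib_mat_vec[OF B u])
  also have "?u \<bullet> ((?B + ?B\<^sup>T) *\<^sub>v ?u) = ?u \<bullet> (?B *\<^sub>v ?u) + ?u \<bullet> (?B\<^sup>T *\<^sub>v ?u)"
    using add_mult_distrib_mat_vec[OF B u] scalar_prod_add_distrib[OF u Bu] by simp
  also have "?u \<bullet> (?B\<^sup>T *\<^sub>v ?u) = ?u \<bullet> (?B *\<^sub>v ?u)"
    using adjoint_scalar_prod[OF B(2) u u] comm_scalar_prod[OF Bu(1) u] by simp
  finally have "?u \<bullet> (Atilde d U j *\<^sub>v ?u) = ?u \<bullet> (?B *\<^sub>v ?u)" by simp
  then show ?thesis using scalar_prod_msum[OF u u, of "ndim d" "\<lambda>i. Acoef d i ?u"] A by simp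
qed

section \<open>The energy balance\<close>

text \<open>What boundary node \<open>j\<close> removes from the energy, per unit of boundary measure and up to the
  factor 2: the flux through the boundary plus the work of the penalty.\<close>

definition bdry_dissipation :: "sbp \<Rightarrow> real \<Rightarrow> real vec \<Rightarrow> nat \<Rightarrow> real" where
  "bdry_dissipation d t U j =
     bdry_val d U j \<bullet> (Atilde d U j *\<^sub>v bdry_val d U j) + bdry_val d U j \<bullet> LC_node d t U j"

text \<open>The discrete energy method: the scheme is tested with \<open>(I \<otimes> P\<^sub>\<Omega>) U\<close>.  In the
  skew-symmetric splitting \<open>D A U + A\<^sup>T D U\<close> the second term tested with \<open>U\<close> is
  \<open>A U\<close> paired with \<open>Q U\<close>, the mirror image of the first, so summation by parts leaves no volume
  term; \<open>C\<close> drops out because it is skew.  Only boundary sums remain.\<close>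

lemma energy_rate:
  assumes d: "sbp_scheme d" and U: "U \<in> carrier_vec (nvar d * nnode d)"
    and st: "\<And>m. m < nnode d \<Longrightarrow> node_val d U m \<in> states d"
    and L: "\<And>j. j < nbdry d \<Longrightarrow> LC_node d t U j \<in> carrier_vec (nvar d)"
    and Ut: "Ut \<in> carrier_vec (nvar d * nnode d)"
    and eq: "kron (Pmat d) (1\<^sub>m (nnode d)) *\<^sub>v Ut
           + vsum (nvar d * nnode d) (ndim d)
               (\<lambda>i. Dx d i *\<^sub>v (block_mat d (Acoef d i) U *\<^sub>v U)
                    + (block_mat d (Acoef d i) U)\<^sup>T *\<^sub>v (Dx d i *\<^sub>v U))
           + block_mat d (Ccoef d) U *\<^sub>v U + LD d t U = 0\<^sub>v (nvar d * nnode d)"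
  shows "U \<bullet> (kron (Pmat d) (POmega d) *\<^sub>v Ut) = - (\<Sum>j<nbdry d. ds d j * bdry_dissipation d t U j)"
proof -
  let ?n = "nvar d" and ?M = "nnode d" and ?N = "nbdry d"
  let ?H = "kron (1\<^sub>m ?n) (POmega d)"
  have P: "Pmat d \<in> carrier_mat ?n ?n" and PO: "POmega d \<in> carrier_mat ?M ?M"
    and diag: "diagonal_mat (POmega d)" and pd: "pos_def (POmega d)"
    and b: "\<And>j. j < ?N \<Longrightarrow> bnode d j < ?M"
    and A: "\<And>i u. i < ndim d \<Longrightarrow> u \<in> states d \<Longrightarrow> Acoef d i u \<in> carrier_mat ?n ?n"
    and C: "\<And>u. u \<in> states d \<Longrightarrow> Ccoef d u \<in> carrier_mat ?n ?n \<and> Ccoef d u + (Ccoef d u)\<^sup>T = 0\<^sub>m ?n ?n"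
    and Q: "\<And>i. i < ndim d \<Longrightarrow> Qmat d i \<in> carrier_mat ?M ?M"
    and sbp: "\<And>i. i < ndim d \<Longrightarrow>
        Qmat d i + (Qmat d i)\<^sup>T = (Emat d)\<^sup>T * Pbdry d * Nmat d i * Emat d"
    using d unfolding sbp_scheme_def by auto
  have "POmega d = mat_diag ?M (\<lambda>m. POmega d $$ (m, m))"
    using PO diag by (intro eq_matI) (auto simp: mat_diag_def diagonal_mat_def)
  then obtain w where POd: "POmega d = mat_diag ?M w" by blast
  note PI = minv_inverts[OF PO pos_def_invertible[OF PO pd]]
  have H: "?H \<in> carrier_mat (?n * ?M) (?n * ?M)" using PO by simp
  have HT: "?H\<^sup>T = ?H"
    by (simp add: POd transpose_kron transpose_mat_diag)
  have commute: "?H * block_mat d B U = block_mat d B U * ?H" for B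
    unfolding POd by (rule weight_commutes_block_mat)
  have HU: "?H *\<^sub>v U \<in> carrier_vec (?n * ?M)" using mult_mat_vec_carrier[OF H U] .
  have weigh: "(?H *\<^sub>v U) \<bullet> v = U \<bullet> (?H *\<^sub>v v)" if "v \<in> carrier_vec (?n * ?M)" for v
    using adjoint_scalar_prod[OF H U that] HT by simp
  \<comment> \<open>Weighting turns \<open>P \<otimes> I\<close> into the matrix \<open>P \<otimes> P\<^sub>\<Omega>\<close> of the energy.\<close>
  have PI1: "kron (Pmat d) (1\<^sub>m ?M) \<in> carrier_mat (?n * ?M) (?n * ?M)" using P by simp
  have PUt: "kron (Pmat d) (1\<^sub>m ?M) *\<^sub>v Ut \<in> carrier_vec (?n * ?M)"
    using mult_mat_vec_carrier[OF PI1 Ut] .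
  have "?H * kron (Pmat d) (1\<^sub>m ?M) = kron (Pmat d) (POmega d)"
    using kron_mult[OF one_carrier_mat P PO one_carrier_mat] P PO by simp
  then have time: "(?H *\<^sub>v U) \<bullet> (kron (Pmat d) (1\<^sub>m ?M) *\<^sub>v Ut) = U \<bullet> (kron (Pmat d) (POmega d) *\<^sub>v Ut)"
    using weigh[OF PUt] assoc_mult_mat_vec[OF H PI1 Ut] by simp
  \<comment> \<open>The weight cancels the inverse quadrature in \<open>D\<close>, and it passes through \<open>A\<^sup>T\<close>.\<close>
  let ?X = "\<lambda>i. Dx d i *\<^sub>v (block_mat d (Acoef d i) U *\<^sub>v U)"
  let ?Y = "\<lambda>i. (block_mat d (Acoef d i) U)\<^sup>T *\<^sub>v (Dx d i *\<^sub>v U)"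
  have D: "Dx d i \<in> carrier_mat (?n * ?M) (?n * ?M)" if "i < ndim d" for i
    unfolding Dx_def using PI(1) Q[OF that] by simp
  have AU: "block_mat d (Acoef d i) U *\<^sub>v U \<in> carrier_vec (?n * ?M)" for i
    using mult_mat_vec_carrier[OF block_mat_carrier U] .
  have BT: "(block_mat d (Acoef d i) U)\<^sup>T \<in> carrier_mat (?n * ?M) (?n * ?M)" for i by simp
  have X: "?X i \<in> carrier_vec (?n * ?M)" if "i < ndim d" for i
    using mult_mat_vec_carrier[OF D[OF that] AU] .
  have DU: "Dx d i *\<^sub>v U \<in> carrier_vec (?n * ?M)" if "i < ndim d" for i
    using mult_mat_vec_carrier[OF D[OF that] U] .
  have Y: "?Y i \<in> carrier_vec (?n * ?M)" if "i < ndim d" for i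
    using mult_mat_vec_carrier[OF BT DU[OF that]] .
  have adv: "(?H *\<^sub>v U) \<bullet> (?X i + ?Y i) = (\<Sum>j<?N. ds d j * (normal d j $ i *
      (bdry_val d U j \<bullet> (Acoef d i (bdry_val d U j) *\<^sub>v bdry_val d U j))))" if i: "i < ndim d" for i
  proof -
    let ?A = "block_mat d (Acoef d i) U" and ?K = "kron (1\<^sub>m ?n) (Qmat d i)"
    have "POmega d * (minv (POmega d) * Qmat d i) = Qmat d i"
      using assoc_mult_mat[OF PO PI(1) Q[OF i]] PI(2) Q[OF i] by simp
    then have HD: "?H * Dx d i = ?K"
      unfolding Dx_def using kron_mult[OF one_carrier_mat one_carrier_mat PO
          mult_carrier_mat[OF PI(1) Q[OF i]]] by simp
    have x: "(?H *\<^sub>v U) \<bullet> ?X i = U \<bullet> (?K *\<^sub>v (?A *\<^sub>v U))"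
      using weigh[OF X[OF i]] assoc_mult_mat_vec[OF H D[OF i] AU] HD by simp
    have "?A *\<^sub>v (?H *\<^sub>v U) = ?H *\<^sub>v (?A *\<^sub>v U)"
      using assoc_mult_mat_vec[OF H block_mat_carrier U, of "Acoef d i" U]
        assoc_mult_mat_vec[OF block_mat_carrier H U, of "Acoef d i" U] commute by simp
    then have "(?H *\<^sub>v U) \<bullet> ?Y i = (?H *\<^sub>v (?A *\<^sub>v U)) \<bullet> (Dx d i *\<^sub>v U)"
      using adjoint_scalar_prod[OF BT HU DU[OF i]] by simp
    also have "\<dots> = (?A *\<^sub>v U) \<bullet> (?H *\<^sub>v (Dx d i *\<^sub>v U))"
      using adjoint_scalar_prod[OF H AU DU[OF i]] HT by simp
    also have "?H *\<^sub>v (Dx d i *\<^sub>v U) = ?K *\<^sub>v U"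
      using assoc_mult_mat_vec[OF H D[OF i] U] HD by simp
    finally have y: "(?H *\<^sub>v U) \<bullet> ?Y i = (?A *\<^sub>v U) \<bullet> (?K *\<^sub>v U)" .
    have "(?H *\<^sub>v U) \<bullet> (?X i + ?Y i) = (\<Sum>j<?N. ds d j * (normal d j $ i *
        (node_val d U (bnode d j) \<bullet> node_val d (?A *\<^sub>v U) (bnode d j))))"
      using scalar_prod_add_distrib[OF HU X[OF i] Y[OF i]] x y
        scalar_prod_sbp[OF U AU b Q[OF i] sbp[OF i]] by simp
    also have "\<dots> = (\<Sum>j<?N. ds d j * (normal d j $ i *
        (bdry_val d U j \<bullet> (Acoef d i (bdry_val d U j) *\<^sub>v bdry_val d U j))))"
      using b A[OF i] st by (intro sum.cong refl)
        (simp add: bdry_val_eq_node_val[OF U] node_val_block_mat[OF U U])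
    finally show ?thesis .
  qed
  have "(\<Sum>i<ndim d. (?H *\<^sub>v U) \<bullet> (?X i + ?Y i)) = (\<Sum>i<ndim d. \<Sum>j<?N. ds d j * (normal d j $ i *
      (bdry_val d U j \<bullet> (Acoef d i (bdry_val d U j) *\<^sub>v bdry_val d U j))))"
    using adv by simp
  also have "\<dots> = (\<Sum>j<?N. \<Sum>i<ndim d. ds d j * (normal d j $ i *
      (bdry_val d U j \<bullet> (Acoef d i (bdry_val d U j) *\<^sub>v bdry_val d U j))))"
    by (rule sum.swap)
  also have "\<dots> = (\<Sum>j<?N. ds d j * (bdry_val d U j \<bullet> (Atilde d U j *\<^sub>v bdry_val d U j)))"
  proof (rule sum.cong[OF refl])
    fix j assume "j \<in> {..<?N}"
    then have "bdry_val d U j \<in> states d" using bdry_val_eq_node_val[OF U _ b] b st by simp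
    then have "Acoef d i (bdry_val d U j) \<in> carrier_mat ?n ?n" if "i < ndim d" for i
      using A[OF that] by blast
    from scalar_prod_Atilde[OF this]
    show "(\<Sum>i<ndim d. ds d j * (normal d j $ i *
        (bdry_val d U j \<bullet> (Acoef d i (bdry_val d U j) *\<^sub>v bdry_val d U j)))) =
      ds d j * (bdry_val d U j \<bullet> (Atilde d U j *\<^sub>v bdry_val d U j))"
      by (simp add: sum_distrib_left)
  qed
  finally have advection: "(\<Sum>i<ndim d. (?H *\<^sub>v U) \<bullet> (?X i + ?Y i)) =
      (\<Sum>j<?N. ds d j * (bdry_val d U j \<bullet> (Atilde d U j *\<^sub>v bdry_val d U j)))" .
  \<comment> \<open>\<open>(I \<otimes> P\<^sub>\<Omega>) C\<close> is skew because the two factors commute.\<close>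
  let ?C = "block_mat d (Ccoef d) U"
  have CU: "?C *\<^sub>v U \<in> carrier_vec (?n * ?M)" using mult_mat_vec_carrier[OF block_mat_carrier U] .
  have skew: "(?H *\<^sub>v U) \<bullet> (?C *\<^sub>v U) = 0"
  proof -
    have CT: "?C\<^sup>T = - ?C" using C st by (intro block_mat_skew) blast
    have CHU: "?C *\<^sub>v (?H *\<^sub>v U) = ?H *\<^sub>v (?C *\<^sub>v U)"
      using assoc_mult_mat_vec[OF H block_mat_carrier U, of "Ccoef d" U]
        assoc_mult_mat_vec[OF block_mat_carrier H U, of "Ccoef d" U] commute by simp
    have dim: "dim_vec (?H *\<^sub>v U) = dim_col ?C"
      using carrier_vecD[OF HU] carrier_matD(2)[OF block_mat_carrier] by simp
    have HCU: "?H *\<^sub>v (?C *\<^sub>v U) \<in> carrier_vec (?n * ?M)" using mult_mat_vec_carrier[OF H CU] .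
    have "(?H *\<^sub>v U) \<bullet> (?C *\<^sub>v U) = (- (?C *\<^sub>v (?H *\<^sub>v U))) \<bullet> U"
      using adjoint_scalar_prod[OF block_mat_carrier HU U, of "Ccoef d" U]
      unfolding CT uminus_mult_mat_vec[OF dim] .
    also have "\<dots> = - ((?H *\<^sub>v U) \<bullet> (?C *\<^sub>v U))"
      unfolding CHU weigh[OF CU] comm_scalar_prod[OF U HCU]
      by (rule scalar_prod_uminus_left) (simp only: carrier_vecD[OF HCU] carrier_vecD[OF U])
    finally show ?thesis by simp
  qed
  \<comment> \<open>The weight also cancels the inverse quadrature in the lifting operator.\<close>
  have Hi: "kron (1\<^sub>m ?n) (minv (POmega d)) \<in> carrier_mat (?n * ?M) (?n * ?M)" using PI(1) by simp
  have DCc: "DC d *\<^sub>v LC d t U \<in> carrier_vec (?n * ?M)"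
    unfolding DC_def carrier_vec_def by (simp add: kron_def Emat_def)
  have LDc: "LD d t U \<in> carrier_vec (?n * ?M)"
    unfolding LD_def using mult_mat_vec_carrier[OF Hi DCc] .
  have "?H * kron (1\<^sub>m ?n) (minv (POmega d)) = 1\<^sub>m (?n * ?M)"
    using kron_mult[OF one_carrier_mat one_carrier_mat PO PI(1)] PI(2) by (simp add: kron_one)
  then have "?H *\<^sub>v LD d t U = DC d *\<^sub>v LC d t U"
    unfolding LD_def using assoc_mult_mat_vec[OF H Hi DCc] DCc by simp
  then have lift: "(?H *\<^sub>v U) \<bullet> LD d t U = (\<Sum>j<?N. ds d j * (bdry_val d U j \<bullet> LC_node d t U j))"
    using weigh[OF LDc] scalar_prod_lifting[OF U L] by simp
  have "0 = (?H *\<^sub>v U) \<bullet> 0\<^sub>v (?n * ?M)" using HU by simp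
  also have "\<dots> = (?H *\<^sub>v U) \<bullet> (kron (Pmat d) (1\<^sub>m ?M) *\<^sub>v Ut)
      + (\<Sum>i<ndim d. (?H *\<^sub>v U) \<bullet> (?X i + ?Y i)) + (?H *\<^sub>v U) \<bullet> (?C *\<^sub>v U) + (?H *\<^sub>v U) \<bullet> LD d t U"
    unfolding eq[symmetric]
    using PUt CU LDc HU X Y
    by (simp add: scalar_prod_add_distrib[of _ "?n * ?M"] scalar_prod_vsum)
  finally show ?thesis
    unfolding time advection skew lift bdry_dissipation_def
    by (simp add: distrib_left sum.distrib)
qed

lemma LC_node_carrier:
  assumes "rotated_bdry d t U j"
  shows "LC_node d t U j \<in> carrier_vec (nvar d)"
proof -
  have "minv (at_bdry d (Tmat d) t U j) \<in> carrier_mat (nvar d) (nvar d)"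
    using assms minv_inverts unfolding rotated_bdry_def Let_def by blast
  then show ?thesis unfolding LC_node_def carrier_vec_def by simp
qed

lemma quadratic_form_derivative:
  fixes K :: "real mat"
  assumes K: "K \<in> carrier_mat k k" "K\<^sup>T = K" and V: "\<And>s. s \<in> I \<Longrightarrow> V s \<in> carrier_vec k"
    and t: "t \<in> I" and Vt: "Vt \<in> carrier_vec k"
    and der: "\<And>r. r < k \<Longrightarrow> ((\<lambda>s. V s $ r) has_real_derivative Vt $ r) (at t within I)"
  shows "((\<lambda>s. V s \<bullet> (K *\<^sub>v V s)) has_real_derivative 2 * (V t \<bullet> (K *\<^sub>v Vt))) (at t within I)"
proof -
  let ?q = "\<lambda>x y. \<Sum>r<k. \<Sum>c<k. x $ r * (K $$ (r, c) * y $ c)"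
  have form: "x \<bullet> (K *\<^sub>v y) = ?q x y" if "x \<in> carrier_vec k" "y \<in> carrier_vec k" for x y
    using that K(1) by (simp add: scalar_prod_def lessThan_atLeast0 sum_distrib_left)
  have "((\<lambda>s. ?q (V s) (V s)) has_real_derivative (\<Sum>r<k. \<Sum>c<k.
      Vt $ r * (K $$ (r, c) * V t $ c) + (K $$ (r, c) * Vt $ c) * V t $ r)) (at t within I)"
    by (intro DERIV_sum DERIV_mult DERIV_cmult der) auto
  also have "(\<Sum>r<k. \<Sum>c<k. Vt $ r * (K $$ (r, c) * V t $ c) + (K $$ (r, c) * Vt $ c) * V t $ r) =
      ?q Vt (V t) + ?q (V t) Vt"
    by (simp add: sum.distrib mult.commute mult.left_commute)
  also have "\<dots> = 2 * (V t \<bullet> (K *\<^sub>v Vt))"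
  proof -
    have KVt: "K *\<^sub>v Vt \<in> carrier_vec k" using mult_mat_vec_carrier[OF K(1) Vt] .
    have "Vt \<bullet> (K *\<^sub>v V t) = V t \<bullet> (K *\<^sub>v Vt)"
      using adjoint_scalar_prod[OF K(1) Vt V[OF t]] K(2) comm_scalar_prod[OF KVt V[OF t]] by simp
    then show ?thesis using form[OF Vt V[OF t]] form[OF V[OF t] Vt] by linarith
  qed
  finally show ?thesis
    by (rule has_field_derivative_transform_within[where d = 1]) (use t in \<open>simp_all add: form V\<close>)
qed

text \<open>Integration of the energy balance.  For the gauge integral the fundamental theorem asks for
  differentiability alone, so the energy rate is integrable as it stands and can be compared with
  its bound.\<close>

lemma energy_estimate:
  assumes d: "sbp_scheme d" and sol: "solution d I V"
    and rot: "\<And>s j. s \<in> I \<Longrightarrow> j < nbdry d \<Longrightarrow> rotated_bdry d s (V s) j"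
    and t: "t \<in> I" and b: "b integrable_on {0..t}"
    and diss: "\<And>s. s \<in> I \<Longrightarrow> - (\<Sum>j<nbdry d. ds d j * bdry_dissipation d s (V s) j) \<le> b s"
  shows "energy d (V t) \<le> energy d (Fvec d) + 2 * integral {0..t} b"
proof -
  let ?K = "kron (Pmat d) (POmega d)"
  let ?e = "\<lambda>s. - 2 * (\<Sum>j<nbdry d. ds d j * bdry_dissipation d s (V s) j)"
  have P: "Pmat d \<in> carrier_mat (nvar d) (nvar d)" "POmega d \<in> carrier_mat (nnode d) (nnode d)"
    "(Pmat d)\<^sup>T = Pmat d" "(POmega d)\<^sup>T = POmega d"
    using d unfolding sbp_scheme_def pos_semidef_def pos_def_def by auto
  have K: "?K \<in> carrier_mat (nvar d * nnode d) (nvar d * nnode d)" "?K\<^sup>T = ?K"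
    using P by (auto simp: transpose_kron)
  have I: "is_interval I" "0 \<in> I" "I \<subseteq> {0..}" "V 0 = Fvec d"
    using sol unfolding solution_def by auto
  have V: "V s \<in> carrier_vec (nvar d * nnode d)" if "s \<in> I" for s
    using sol that unfolding solution_def by auto
  have der: "((\<lambda>s. energy d (V s)) has_real_derivative ?e s) (at s within I)" if s: "s \<in> I" for s
  proof -
    from sol s obtain Vt where Vt: "Vt \<in> carrier_vec (nvar d * nnode d)"
      and D: "\<And>r. r < nvar d * nnode d \<Longrightarrow> ((\<lambda>s. V s $ r) has_real_derivative Vt $ r) (at s within I)"
      and st: "\<And>m. m < nnode d \<Longrightarrow> node_val d (V s) m \<in> states d"
      and eq: "kron (Pmat d) (1\<^sub>m (nnode d)) *\<^sub>v Vt
           + vsum (nvar d * nnode d) (ndim d)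
               (\<lambda>i. Dx d i *\<^sub>v (block_mat d (Acoef d i) (V s) *\<^sub>v V s)
                    + (block_mat d (Acoef d i) (V s))\<^sup>T *\<^sub>v (Dx d i *\<^sub>v V s))
           + block_mat d (Ccoef d) (V s) *\<^sub>v V s + LD d s (V s) = 0\<^sub>v (nvar d * nnode d)"
      unfolding solution_def by blast
    have "V s \<bullet> (?K *\<^sub>v Vt) = - (\<Sum>j<nbdry d. ds d j * bdry_dissipation d s (V s) j)"
      using energy_rate[OF d V[OF s] st LC_node_carrier[OF rot[OF s]] Vt eq] by simp
    then show ?thesis
      using quadratic_form_derivative[OF K V s Vt D] unfolding energy_def by simp
  qed
  have sub: "{0..t} \<subseteq> I" using I t mem_is_interval_1_I[OF I(1,2) t] by auto
  have t0: "0 \<le> t" using I t by auto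
  have "(?e has_integral (energy d (V t) - energy d (V 0))) {0..t}"
  proof (rule fundamental_theorem_of_calculus[OF t0])
    fix s assume "s \<in> {0..t}"
    then have "s \<in> I" using sub by blast
    from has_field_derivative_subset[OF der[OF this] sub]
    show "((\<lambda>s. energy d (V s)) has_vector_derivative ?e s) (at s within {0..t})"
      by (simp only: has_real_derivative_iff_has_vector_derivative)
  qed
  moreover have "((\<lambda>s. 2 * b s) has_integral (2 * integral {0..t} b)) {0..t}"
    using b by (intro has_integral_mult_right integrable_integral)
  ultimately have "energy d (V t) - energy d (V 0) \<le> 2 * integral {0..t} b"
    by (rule has_integral_le) (use diss sub in force)
  then show ?thesis using I by simp
qed

section \<open>Dissipation at a boundary node\<close>

lemma selection_matE:
  assumes "selection_mat n K J"
  obtains ks where "distinct ks" "set ks = K" "length ks = card K"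
    "J = mat (card K) n (\<lambda>(r, c). if c = ks ! r then 1 else 0)"
  using assms distinct_card unfolding selection_mat_def by metis

lemma sum_over_listed_set:
  assumes "distinct ks"
  shows "(\<Sum>r<length ks. f (ks ! r)) = (\<Sum>i\<in>set ks. f i)"
  using sum.reindex_bij_betw[OF bij_betw_nth[OF assms refl refl], of f] by simp

lemma selection_mult_vec:
  assumes J: "J = mat k n (\<lambda>(r, c). if c = ks ! r then 1 else (0::real))"
    and w: "w \<in> carrier_vec n" and r: "r < k" "ks ! r < n"
  shows "(J *\<^sub>v w) $ r = w $ (ks ! r)"
proof -
  have "(J *\<^sub>v w) $ r = (\<Sum>c<n. (if c = ks ! r then 1 else 0) * w $ c)"
    using w r by (simp add: J scalar_prod_def lessThan_atLeast0)
  also have "\<dots> = (\<Sum>c<n. if c = ks ! r then w $ c else 0)"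
    by (rule sum.cong) auto
  finally show ?thesis using r by simp
qed

lemma selection_mat_diag:
  assumes J: "J = mat k n (\<lambda>(r, c). if c = ks ! r then 1 else (0::real))"
    and ks: "distinct ks" "length ks = k" "set ks \<subseteq> {..<n}"
  shows "J * mat_diag n f * J\<^sup>T = mat_diag k (\<lambda>r. f (ks ! r))"
proof (rule eq_matI)
  fix i j assume "i < dim_row (mat_diag k (\<lambda>r. f (ks ! r)))" "j < dim_col (mat_diag k (\<lambda>r. f (ks ! r)))"
  then have ij: "i < k" "j < k" by (auto simp: mat_diag_def)
  have Jc: "J \<in> carrier_mat k n" by (simp add: J)
  have lt: "ks ! i < n" "ks ! j < n" using ks ij nth_mem by blast+
  have "(J * mat_diag n f * J\<^sup>T) $$ (i, j) =
      (\<Sum>c<n. (if c = ks ! i then 1 else 0) * f c * (if c = ks ! j then 1 else 0))"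
    unfolding mat_diag_mult_right[OF Jc] using ij
    by (simp add: J scalar_prod_def lessThan_atLeast0)
  also have "\<dots> = (\<Sum>c<n. if c = ks ! i then (if ks ! i = ks ! j then f c else 0) else 0)"
    by (rule sum.cong) auto
  also have "\<dots> = mat_diag k (\<lambda>r. f (ks ! r)) $$ (i, j)"
    using ij lt ks nth_eq_iff_index_eq[OF ks(1)] by (auto simp: mat_diag_def)
  finally show "(J * mat_diag n f * J\<^sup>T) $$ (i, j) = mat_diag k (\<lambda>r. f (ks ! r)) $$ (i, j)" .
qed (auto simp: mat_diag_def J)

lemma map_mat_diag: "f 0 = 0 \<Longrightarrow> map_mat f (mat_diag k c) = mat_diag k (\<lambda>r. f (c r))"
  by (rule eq_matI) (auto simp: mat_diag_def)

text \<open>A selection matrix restricts a diagonal matrix to a diagonal matrix, and its quadratic form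
  to a partial sum.  The order in which \<open>J\<close> lists the indices is immaterial, which is why the
  diagonal \<open>c\<close> is left unspecified apart from its values.\<close>

lemma selected_form:
  assumes J: "selection_mat n K J" and K: "K \<subseteq> {..<n}" and w: "w \<in> carrier_vec n"
  shows "\<exists>c. J \<in> carrier_mat (card K) n \<and> J * mat_diag n f * J\<^sup>T = mat_diag (card K) c \<and>
    (J *\<^sub>v w) \<bullet> (mat_diag (card K) c *\<^sub>v (J *\<^sub>v w)) = (\<Sum>i\<in>K. f i * (w $ i * w $ i)) \<and>
    (\<forall>r<card K. c r \<in> f ` K)"
proof -
  obtain ks where ks: "distinct ks" "set ks = K" "length ks = card K"
    and Jdef: "J = mat (card K) n (\<lambda>(r, c). if c = ks ! r then 1 else 0)"
    using selection_matE[OF J] .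
  have Jc: "J \<in> carrier_mat (card K) n" by (simp add: Jdef)
  have Jw: "J *\<^sub>v w \<in> carrier_vec (card K)" using mult_mat_vec_carrier[OF Jc w] .
  have mem: "ks ! r \<in> K" if "r < card K" for r using that ks nth_mem by metis
  have "(J *\<^sub>v w) \<bullet> (mat_diag (card K) (\<lambda>r. f (ks ! r)) *\<^sub>v (J *\<^sub>v w)) =
      (\<Sum>r<length ks. f (ks ! r) * (w $ (ks ! r) * w $ (ks ! r)))"
    unfolding scalar_prod_mat_diag[OF Jw Jw] ks(3)
    using selection_mult_vec[OF Jdef w _ subsetD[OF K mem, simplified]] by (intro sum.cong refl) simp
  also have "\<dots> = (\<Sum>i\<in>K. f i * (w $ i * w $ i))"
    using sum_over_listed_set[OF ks(1), of "\<lambda>i. f i * (w $ i * w $ i)"] ks(2) by simp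
  finally show ?thesis
    using Jc mem selection_mat_diag[OF Jdef ks(1,3)] ks(2) K by (intro exI[of _ "\<lambda>r. f (ks ! r)"]) auto
qed

text \<open>In rotated variables the flux splits into the contributions of \<open>\<Lambda>\<^sup>+\<close> and \<open>\<Lambda>\<^sup>-\<close>, the zero
  entries of \<open>\<Lambda>\<close> contributing nothing, and the penalty is tested against \<open>W\<^sup>-\<close> alone.  Here \<open>w\<close> is \<open>W\<^sup>+\<close> and
  \<open>z\<close> is \<open>|\<Lambda>\<^sup>-|^{1/2} (W\<^sup>- - R W\<^sup>+)\<close>.  The data enter only through
  \<open>g = |\<Lambda>\<^sup>-|^{1/2} S^{-1} G\<close>.\<close>

lemma rotated_dissipation:
  assumes rot: "rotated_bdry d t U j"
    and Sig: "at_bdry d (Sigmat d) t U j = abs_Lam_minus d t U j"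
  defines "a \<equiv> card (pos_idx d t U j)" and "b \<equiv> card (neg_idx d t U j)"
    and "R \<equiv> at_bdry d (Rmat d) t U j" and "s \<equiv> sqrt_abs_Lam_minus d t U j"
    and "g \<equiv> sqrt_abs_Lam_minus d t U j *\<^sub>v (minv (at_bdry d (Smat d) t U j) *\<^sub>v Gbdry d t j)"
  obtains w z where "w \<in> carrier_vec a" "z \<in> carrier_vec b"
    "Lam_plus d t U j \<in> carrier_mat a a" "Lam_minus d t U j \<in> carrier_mat b b"
    "bdry_dissipation d t U j =
       w \<bullet> (bdry_form d t U j *\<^sub>v w) + z \<bullet> z - 2 * (z \<bullet> g) - 2 * (((s * R) *\<^sub>v w) \<bullet> g)"
proof -
  let ?n = "nvar d" and ?u = "bdry_val d U j" and ?W = "Wvec d t U j"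
  let ?T = "at_bdry d (Tmat d) t U j" and ?S = "at_bdry d (Smat d) t U j"
  let ?Jp = "at_bdry d (Jplus d) t U j" and ?Jm = "at_bdry d (Jminus d) t U j"
  let ?G = "Gbdry d t j" and ?L = "abs_Lam_minus d t U j"
  let ?l = "at_bdry d (lam d) t U j"
  have T: "?T \<in> carrier_mat ?n ?n" "invertible_mat ?T"
    and At: "?u \<bullet> (Atilde d U j *\<^sub>v ?u) = ?W \<bullet> (Lam d t U j *\<^sub>v ?W)"
    and Jp: "selection_mat ?n (pos_idx d t U j) ?Jp" and Jm: "selection_mat ?n (neg_idx d t U j) ?Jm"
    and R: "R \<in> carrier_mat b a" and S: "?S \<in> carrier_mat b b" "invertible_mat ?S"
    and G: "?G \<in> carrier_vec b"
    using rot unfolding rotated_bdry_def Let_def a_def b_def R_def by auto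
  note Ti = minv_inverts[OF T] and Si = minv_inverts[OF S]
  have W: "?W \<in> carrier_vec ?n"
    unfolding Wvec_def using mult_mat_vec_carrier[OF Ti(1) bdry_val_carrier] .
  have sub: "pos_idx d t U j \<subseteq> {..<?n}" "neg_idx d t U j \<subseteq> {..<?n}"
    by (auto simp: pos_idx_def neg_idx_def)
  obtain cp where Jpc: "?Jp \<in> carrier_mat a ?n" and Lp: "Lam_plus d t U j = mat_diag a cp"
    and Fp: "(?Jp *\<^sub>v ?W) \<bullet> (mat_diag a cp *\<^sub>v (?Jp *\<^sub>v ?W)) =
      (\<Sum>i\<in>pos_idx d t U j. ?l i * (?W $ i * ?W $ i))"
    using selected_form[OF Jp sub(1) W, of ?l] unfolding Lam_plus_def Lam_def a_def
    by (elim exE conjE) blast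
  obtain cm where Jmc: "?Jm \<in> carrier_mat b ?n" and Lm: "Lam_minus d t U j = mat_diag b cm"
    and Fm: "(?Jm *\<^sub>v ?W) \<bullet> (mat_diag b cm *\<^sub>v (?Jm *\<^sub>v ?W)) =
      (\<Sum>i\<in>neg_idx d t U j. ?l i * (?W $ i * ?W $ i))"
    and cm: "\<And>r. r < b \<Longrightarrow> cm r \<in> ?l ` neg_idx d t U j"
    using selected_form[OF Jm sub(2) W, of ?l] unfolding Lam_minus_def Lam_def b_def
    by (elim exE conjE) blast
  let ?wp = "Wplus d t U j" and ?wm = "Wminus d t U j"
  let ?h = "minv ?S *\<^sub>v ?G"
  have wp: "?wp \<in> carrier_vec a" and wm: "?wm \<in> carrier_vec b" and h: "?h \<in> carrier_vec b"
    unfolding Wplus_def Wminus_def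
    using mult_mat_vec_carrier[OF Jpc W] mult_mat_vec_carrier[OF Jmc W] mult_mat_vec_carrier[OF Si(1) G] .
  have L: "?L = mat_diag b (\<lambda>r. \<bar>cm r\<bar>)"
    unfolding abs_Lam_minus_def Lm by (rule map_mat_diag) simp
  have s: "s = mat_diag b (\<lambda>r. sqrt \<bar>cm r\<bar>)"
    unfolding s_def sqrt_abs_Lam_minus_def L by (rule map_mat_diag) simp
  have sc: "s \<in> carrier_mat b b" and sT: "s\<^sup>T = s" by (simp_all add: s transpose_mat_diag)
  have ss: "?L = s * s" unfolding L s by simp
  have Lc: "?L \<in> carrier_mat b b" by (simp add: L)
  \<comment> \<open>On the negative indices \<open>\<lambda> = - |\<lambda>|\<close>, which gives the sign in front of \<open>s * s\<close>.\<close>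
  have "?W \<bullet> (Lam d t U j *\<^sub>v ?W) = (\<Sum>i<?n. ?l i * (?W $ i * ?W $ i))"
    unfolding Lam_def by (rule scalar_prod_mat_diag[OF W W])
  also have "\<dots> = (\<Sum>i\<in>pos_idx d t U j \<union> neg_idx d t U j. ?l i * (?W $ i * ?W $ i))"
    by (rule sum.mono_neutral_right) (auto simp: pos_idx_def neg_idx_def)
  also have "\<dots> = (\<Sum>i\<in>pos_idx d t U j. ?l i * (?W $ i * ?W $ i)) +
      (\<Sum>i\<in>neg_idx d t U j. ?l i * (?W $ i * ?W $ i))"
    using sub by (intro sum.union_disjoint) (auto simp: pos_idx_def neg_idx_def)
  also have "\<dots> = ?wp \<bullet> (Lam_plus d t U j *\<^sub>v ?wp) + ?wm \<bullet> (mat_diag b cm *\<^sub>v ?wm)"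
    using Fp Fm Lp by (simp add: Wplus_def Wminus_def)
  also have "?wm \<bullet> (mat_diag b cm *\<^sub>v ?wm) = - (?wm \<bullet> ((s * s) *\<^sub>v ?wm))"
  proof -
    have "\<bar>cm r\<bar> = - cm r" if "r < b" for r
      using cm[OF that] by (auto simp: neg_idx_def)
    then show ?thesis
      unfolding ss[symmetric] L scalar_prod_mat_diag[OF wm wm] by (simp flip: sum_negf)
  qed
  finally have flux: "?u \<bullet> (Atilde d U j *\<^sub>v ?u) =
      ?wp \<bullet> (Lam_plus d t U j *\<^sub>v ?wp) - ?wm \<bullet> ((s * s) *\<^sub>v ?wm)"
    using At by simp
  \<comment> \<open>The factor \<open>(J\<^sup>- T^{-1})\<^sup>T\<close> of the penalty turns the test vector \<open>u\<close> into \<open>W\<^sup>-\<close>.\<close>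
  let ?r = "?wm - R *\<^sub>v ?wp - ?h"
  have Rwp: "R *\<^sub>v ?wp \<in> carrier_vec b" using mult_mat_vec_carrier[OF R wp] .
  have r: "?r \<in> carrier_vec b" using wm Rwp h by simp
  have Lr: "?L *\<^sub>v ?r \<in> carrier_vec b" using mult_mat_vec_carrier[OF Lc r] .
  have JT: "?Jm * minv ?T \<in> carrier_mat b ?n" "(?Jm * minv ?T)\<^sup>T \<in> carrier_mat ?n b"
    using Jmc Ti(1) by auto
  have JLr: "(?Jm * minv ?T)\<^sup>T *\<^sub>v (?L *\<^sub>v ?r) \<in> carrier_vec ?n"
    using mult_mat_vec_carrier[OF JT(2) Lr] .
  have "?u \<bullet> LC_node d t U j = 2 * (?u \<bullet> ((?Jm * minv ?T)\<^sup>T *\<^sub>v (?L *\<^sub>v ?r)))"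
    unfolding LC_node_def Sig R_def[symmetric]
    by (rule scalar_prod_smult_distrib[OF bdry_val_carrier JLr])
  also have "?u \<bullet> ((?Jm * minv ?T)\<^sup>T *\<^sub>v (?L *\<^sub>v ?r)) = ((?Jm * minv ?T) *\<^sub>v ?u) \<bullet> (?L *\<^sub>v ?r)"
    using adjoint_scalar_prod[OF JT(2) bdry_val_carrier Lr] by simp
  also have "(?Jm * minv ?T) *\<^sub>v ?u = ?wm"
    unfolding Wminus_def Wvec_def by (rule assoc_mult_mat_vec[OF Jmc Ti(1) bdry_val_carrier])
  finally have penalty: "?u \<bullet> LC_node d t U j = 2 * (?wm \<bullet> ((s * s) *\<^sub>v ?r))"
    unfolding ss .
  have Lpc: "Lam_plus d t U j \<in> carrier_mat a a" by (simp add: Lp)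
  have "bdry_dissipation d t U j = ?wp \<bullet> ((Lam_plus d t U j - R\<^sup>T * (s * s) * R) *\<^sub>v ?wp) +
      (s *\<^sub>v (?wm - R *\<^sub>v ?wp)) \<bullet> (s *\<^sub>v (?wm - R *\<^sub>v ?wp)) -
      2 * ((s *\<^sub>v (?wm - R *\<^sub>v ?wp)) \<bullet> (s *\<^sub>v ?h)) - 2 * (((s * R) *\<^sub>v ?wp) \<bullet> (s *\<^sub>v ?h))"
    unfolding bdry_dissipation_def flux penalty
    by (rule boundary_completion[OF Lpc sc sT R wp wm h])
  then show thesis
    by (intro that[of ?wp "s *\<^sub>v (?wm - R *\<^sub>v ?wp)"])
      (use wp wm Rwp sc Lm Lpc mult_mat_vec_carrier[OF sc] in
        \<open>auto simp: bdry_form_def Let_def ss g_def s_def R_def\<close>)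
qed

lemma homogeneous_dissipation:
  assumes rot: "rotated_bdry d t U j"
    and Sig: "at_bdry d (Sigmat d) t U j = abs_Lam_minus d t U j"
    and psd: "pos_semidef (bdry_form d t U j)"
    and G: "Gbdry d t j = 0\<^sub>v (card (neg_idx d t U j))"
  shows "0 \<le> bdry_dissipation d t U j"
proof -
  let ?b = "card (neg_idx d t U j)" and ?a = "card (pos_idx d t U j)"
  let ?S = "at_bdry d (Smat d) t U j" and ?R = "at_bdry d (Rmat d) t U j"
  let ?s = "sqrt_abs_Lam_minus d t U j"
  let ?g = "?s *\<^sub>v (minv ?S *\<^sub>v Gbdry d t j)"
  obtain w z where wz: "w \<in> carrier_vec ?a" "z \<in> carrier_vec ?b"
    and Lc: "Lam_plus d t U j \<in> carrier_mat ?a ?a" "Lam_minus d t U j \<in> carrier_mat ?b ?b"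
    and eq: "bdry_dissipation d t U j =
       w \<bullet> (bdry_form d t U j *\<^sub>v w) + z \<bullet> z - 2 * (z \<bullet> ?g) - 2 * (((?s * ?R) *\<^sub>v w) \<bullet> ?g)"
    using rotated_dissipation[OF rot Sig] .
  have S: "?S \<in> carrier_mat ?b ?b" "invertible_mat ?S" and R: "?R \<in> carrier_mat ?b ?a"
    using rot unfolding rotated_bdry_def Let_def by auto
  have s: "?s \<in> carrier_mat ?b ?b"
    using Lc by (simp add: sqrt_abs_Lam_minus_def abs_Lam_minus_def)
  have g: "?g = 0\<^sub>v ?b"
    unfolding G mult_mat_zero_vec[OF minv_inverts(1)[OF S]] by (rule mult_mat_zero_vec[OF s])
  have sR: "?s * ?R \<in> carrier_mat ?b ?a" using s R by simp
  have "((?s * ?R) *\<^sub>v w) \<in> carrier_vec ?b" using mult_mat_vec_carrier[OF sR wz(1)] .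
  moreover have "dim_row (bdry_form d t U j) = ?a"
    using Lc R by (simp add: bdry_form_def Let_def)
  ultimately show ?thesis
    unfolding eq g using wz psd scalar_prod_self_nonneg[of z] by (simp add: pos_semidef_def)
qed

text \<open>The constant of \<open>pos_def_young\<close> as a function of the two matrices, so that the threshold for
  \<open>S\<^sub>0\<close> can be fixed before any solution is given.\<close>

definition young_const :: "real mat \<Rightarrow> real mat \<Rightarrow> real" where
  "young_const B X = (SOME c. 0 \<le> c \<and>
     (\<forall>w\<in>carrier_vec (dim_col X). \<forall>g\<in>carrier_vec (dim_row X).
        2 * ((X *\<^sub>v w) \<bullet> g) \<le> w \<bullet> (B *\<^sub>v w) + c * (g \<bullet> g)))"

lemma young_const:
  assumes B: "B \<in> carrier_mat a a" "pos_def B" and X: "X \<in> carrier_mat b a"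
  shows "0 \<le> young_const B X"
    and "\<lbrakk>w \<in> carrier_vec a; g \<in> carrier_vec b\<rbrakk> \<Longrightarrow>
      2 * ((X *\<^sub>v w) \<bullet> g) \<le> w \<bullet> (B *\<^sub>v w) + young_const B X * (g \<bullet> g)"
proof -
  have dims: "dim_col X = a" "dim_row X = b" using X by auto
  note * = someI_ex[OF pos_def_young[OF B X, folded dims], folded young_const_def, unfolded dims]
  show "0 \<le> young_const B X" by (rule conjunct1[OF *])
  show "2 * ((X *\<^sub>v w) \<bullet> g) \<le> w \<bullet> (B *\<^sub>v w) + young_const B X * (g \<bullet> g)"
    if "w \<in> carrier_vec a" "g \<in> carrier_vec b"
    by (rule bspec[OF bspec[OF conjunct2[OF *] that(1)] that(2)])
qed

text \<open>The threshold for the norm of \<open>S\<^sub>0\<close>, where \<open>S = S\<^sub>0^{-1} |\<Lambda>\<^sup>-|^{1/2}\<close>.  Absorbing the cross terms with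
  \<open>g = S\<^sub>0 G\<close> costs at most \<open>(1 + c) g \<bullet> g\<close> with \<open>c\<close> the Young constant, and this is at most
  \<open>G \<bullet> G\<close> when \<open>(1 + c)\<close> times the squared norm of \<open>S\<^sub>0\<close> is at most 1.  The absolute value keeps
  the threshold positive where the form is not definite and the chosen constant is arbitrary.\<close>

definition Stilde_bound :: "real mat \<Rightarrow> real mat \<Rightarrow> real mat \<Rightarrow> real" where
  "Stilde_bound Lp Lm R = 1 / sqrt (1 + \<bar>young_const
     (Lp - R\<^sup>T * map_mat abs Lm * R) (map_mat sqrt (map_mat abs Lm) * R)\<bar>)"

text \<open>With \<open>S = S\<^sub>0^{-1} s\<close> the vector \<open>h = S^{-1} G\<close> solves \<open>S\<^sub>0^{-1} s h = G\<close>, that is,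
  \<open>s h = S\<^sub>0 G\<close>.  No inverse of the weight \<open>s\<close> survives.\<close>

lemma scaled_data:
  assumes S0: "S0 \<in> carrier_mat b b" "invertible_mat S0" and s: "s \<in> carrier_mat b b"
    and S: "minv S0 * s \<in> carrier_mat b b" "invertible_mat (minv S0 * s)" and G: "G \<in> carrier_vec b"
  shows "s *\<^sub>v (minv (minv S0 * s) *\<^sub>v G) = S0 *\<^sub>v G"
proof -
  let ?h = "minv (minv S0 * s) *\<^sub>v G"
  note Si = minv_inverts[OF S] and S0i = minv_inverts[OF S0]
  have h: "?h \<in> carrier_vec b" using mult_mat_vec_carrier[OF Si(1) G] .
  have sh: "s *\<^sub>v ?h \<in> carrier_vec b" using mult_mat_vec_carrier[OF s h] .
  have "minv S0 *\<^sub>v (s *\<^sub>v ?h) = G"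
    using assoc_mult_mat_vec[OF S0i(1) s h] assoc_mult_mat_vec[OF S(1) Si(1) G] Si(2) G by simp
  then show ?thesis
    using assoc_mult_mat_vec[OF S0(1) S0i(1) sh] S0i(2) sh by simp
qed

text \<open>Strictness of the boundary condition pays for the data: the cross term with \<open>W\<^sup>+\<close> is absorbed
  by the positive definite form, the one with the residual by its square, and both leave a multiple
  of \<open>g \<bullet> g\<close> that a small \<open>S\<^sub>0\<close> turns into at most \<open>G \<bullet> G\<close>.\<close>

lemma inhomogeneous_dissipation:
  assumes rot: "rotated_bdry d t U j"
    and Sig: "at_bdry d (Sigmat d) t U j = abs_Lam_minus d t U j"
    and pd: "pos_def (bdry_form d t U j)"
    and S0: "S0 \<in> carrier_mat (card (neg_idx d t U j)) (card (neg_idx d t U j))" "invertible_mat S0"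
    and small: "mat_norm S0 \<le>
      Stilde_bound (Lam_plus d t U j) (Lam_minus d t U j) (at_bdry d (Rmat d) t U j)"
    and S: "at_bdry d (Smat d) t U j = minv S0 * sqrt_abs_Lam_minus d t U j"
  shows "- bdry_dissipation d t U j \<le> Gbdry d t j \<bullet> Gbdry d t j"
proof -
  let ?b = "card (neg_idx d t U j)" and ?a = "card (pos_idx d t U j)"
  let ?S = "at_bdry d (Smat d) t U j" and ?R = "at_bdry d (Rmat d) t U j"
  let ?s = "sqrt_abs_Lam_minus d t U j" and ?G = "Gbdry d t j"
  let ?g = "?s *\<^sub>v (minv ?S *\<^sub>v ?G)"
  let ?c = "young_const (bdry_form d t U j) (?s * ?R)"
  obtain w z where wz: "w \<in> carrier_vec ?a" "z \<in> carrier_vec ?b"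
    and Lc: "Lam_plus d t U j \<in> carrier_mat ?a ?a" "Lam_minus d t U j \<in> carrier_mat ?b ?b"
    and eq: "bdry_dissipation d t U j =
       w \<bullet> (bdry_form d t U j *\<^sub>v w) + z \<bullet> z - 2 * (z \<bullet> ?g) - 2 * (((?s * ?R) *\<^sub>v w) \<bullet> ?g)"
    using rotated_dissipation[OF rot Sig] .
  have Sc: "?S \<in> carrier_mat ?b ?b" "invertible_mat ?S" and R: "?R \<in> carrier_mat ?b ?a"
    and G: "?G \<in> carrier_vec ?b"
    using rot unfolding rotated_bdry_def Let_def by auto
  have s: "?s \<in> carrier_mat ?b ?b"
    using Lc by (simp add: sqrt_abs_Lam_minus_def abs_Lam_minus_def)
  have g: "?g = S0 *\<^sub>v ?G"
    unfolding S using scaled_data[OF S0 s] Sc G unfolding S by blast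
  have gc: "?g \<in> carrier_vec ?b" unfolding g using mult_mat_vec_carrier[OF S0(1) G] .
  have sR: "?s * ?R \<in> carrier_mat ?b ?a" using s R by simp
  have "dim_row (bdry_form d t U j) = ?a" "dim_col (bdry_form d t U j) = ?a"
    using Lc R by (simp_all add: bdry_form_def Let_def)
  then have form: "bdry_form d t U j \<in> carrier_mat ?a ?a" by (rule carrier_matI)
  have c0: "0 \<le> ?c" by (rule young_const(1)[OF form pd sR])
  have bound: "mat_norm S0 \<le> 1 / sqrt (1 + ?c)"
    using small c0 by (simp add: Stilde_bound_def bdry_form_def Let_def abs_Lam_minus_def sqrt_abs_Lam_minus_def)
  have "2 * (((?s * ?R) *\<^sub>v w) \<bullet> ?g) \<le> w \<bullet> (bdry_form d t U j *\<^sub>v w) + ?c * (?g \<bullet> ?g)"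
    by (rule young_const(2)[OF form pd sR wz(1) gc])
  then have "- bdry_dissipation d t U j \<le> (1 + ?c) * (?g \<bullet> ?g)"
    using eq square_minus_ge[OF wz(2) gc] by (simp add: distrib_right)
  also have "\<dots> \<le> (1 + ?c) * ((mat_norm S0)\<^sup>2 * (?G \<bullet> ?G))"
    unfolding g using mat_norm_bound[OF S0(1) G] c0 by (intro mult_left_mono) auto
  also have "\<dots> \<le> ?G \<bullet> ?G"
  proof -
    have c: "0 < 1 + ?c" using c0 by simp
    have "(mat_norm S0)\<^sup>2 \<le> (1 / sqrt (1 + ?c))\<^sup>2"
      by (rule power_mono[OF bound mat_norm_nonneg[OF S0(1)]])
    also have "\<dots> = 1 / (1 + ?c)" using c by (simp add: power_divide)
    finally have "(1 + ?c) * (mat_norm S0)\<^sup>2 \<le> 1" using c by (simp add: field_simps)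
    then show ?thesis
      using mult_right_mono[OF _ scalar_prod_self_nonneg[of ?G]] by (fastforce simp: mult.assoc)
  qed
  finally show ?thesis .
qed

theorem proposition5p1:
  shows
   "(\<forall>d I V.
       sbp_scheme d \<and> solution d I V \<and> (\<forall>t\<in>I. \<forall>j<nbdry d. rotated_bdry d t (V t) j) \<and>
       (\<forall>t\<in>I. \<forall>j<nbdry d.
          Gbdry d t j = 0\<^sub>v (card (neg_idx d t (V t) j)) \<and>
          pos_semidef (bdry_form d t (V t) j) \<and>
          at_bdry d (Sigmat d) t (V t) j = abs_Lam_minus d t (V t) j)
       \<longrightarrow> (\<forall>t\<in>I. energy d (V t) \<le> energy d (Fvec d)))
    \<and>
    (\<exists>\<delta> :: real mat \<Rightarrow> real mat \<Rightarrow> real mat \<Rightarrow> real.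
       (\<forall>Lp Lm R. \<delta> Lp Lm R > 0) \<and>
       (\<forall>d I V (S_tilde :: real mat bcoef).
          sbp_scheme d \<and> solution d I V \<and> (\<forall>t\<in>I. \<forall>j<nbdry d. rotated_bdry d t (V t) j) \<and>
          (\<forall>t\<in>I. bdry_data_sq d integrable_on {0..t}) \<and>
          (\<forall>t\<in>I. \<forall>j<nbdry d.
             pos_def (bdry_form d t (V t) j) \<and>
             (let S\<^sub>0 = at_bdry d S_tilde t (V t) j; n_minus = card (neg_idx d t (V t) j) in
                S\<^sub>0 \<in> carrier_mat n_minus n_minus \<and> invertible_mat S\<^sub>0 \<and>
                mat_norm S\<^sub>0 \<le> \<delta> (Lam_plus d t (V t) j) (Lam_minus d t (V t) j)
                                  (at_bdry d (Rmat d) t (V t) j) \<and>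
                at_bdry d (Smat d) t (V t) j = minv S\<^sub>0 * sqrt_abs_Lam_minus d t (V t) j) \<and>
             at_bdry d (Sigmat d) t (V t) j = abs_Lam_minus d t (V t) j)
          \<longrightarrow> (\<forall>t\<in>I. energy d (V t) \<le>
                energy d (Fvec d) + 2 * integral {0..t} (bdry_data_sq d))))"
proof (intro conjI exI[of _ Stilde_bound] allI impI ballI; (elim conjE)?)
  fix d I V t
  assume d: "sbp_scheme d" and sol: "solution d I V" and t: "t \<in> I"
    and rot: "\<forall>t\<in>I. \<forall>j<nbdry d. rotated_bdry d t (V t) j"
    and bc: "\<forall>t\<in>I. \<forall>j<nbdry d. Gbdry d t j = 0\<^sub>v (card (neg_idx d t (V t) j)) \<and>
          pos_semidef (bdry_form d t (V t) j) \<and>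
          at_bdry d (Sigmat d) t (V t) j = abs_Lam_minus d t (V t) j"
  have "- (\<Sum>j<nbdry d. ds d j * bdry_dissipation d s (V s) j) \<le> 0" if "s \<in> I" for s
  proof -
    have "0 \<le> (\<Sum>j<nbdry d. ds d j * bdry_dissipation d s (V s) j)"
      using that d rot bc by (intro sum_nonneg mult_nonneg_nonneg homogeneous_dissipation)
        (auto simp: sbp_scheme_def intro: less_imp_le)
    then show ?thesis by simp
  qed
  then show "energy d (V t) \<le> energy d (Fvec d)"
    using energy_estimate[OF d sol _ t integrable_0] rot by simp
next
  fix Lp Lm R
  show "0 < Stilde_bound Lp Lm R"
    by (simp add: Stilde_bound_def add_pos_nonneg)
next
  fix d I V t and S_tilde :: "real mat bcoef"
  assume d: "sbp_scheme d" and sol: "solution d I V" and t: "t \<in> I"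
    and rot: "\<forall>t\<in>I. \<forall>j<nbdry d. rotated_bdry d t (V t) j"
    and int: "\<forall>t\<in>I. bdry_data_sq d integrable_on {0..t}"
    and bc: "\<forall>t\<in>I. \<forall>j<nbdry d.
             pos_def (bdry_form d t (V t) j) \<and>
             (let S\<^sub>0 = at_bdry d S_tilde t (V t) j; n_minus = card (neg_idx d t (V t) j) in
                S\<^sub>0 \<in> carrier_mat n_minus n_minus \<and> invertible_mat S\<^sub>0 \<and>
                mat_norm S\<^sub>0 \<le> Stilde_bound (Lam_plus d t (V t) j) (Lam_minus d t (V t) j)
                                  (at_bdry d (Rmat d) t (V t) j) \<and>
                at_bdry d (Smat d) t (V t) j = minv S\<^sub>0 * sqrt_abs_Lam_minus d t (V t) j) \<and>
             at_bdry d (Sigmat d) t (V t) j = abs_Lam_minus d t (V t) j"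
  have "- (\<Sum>j<nbdry d. ds d j * bdry_dissipation d s (V s) j) \<le> bdry_data_sq d s" if s: "s \<in> I" for s
    unfolding bdry_data_sq_def sum_negf[symmetric]
  proof (rule sum_mono)
    fix j assume "j \<in> {..<nbdry d}"
    then have j: "j < nbdry d" by simp
    have "- bdry_dissipation d s (V s) j \<le> Gbdry d s j \<bullet> Gbdry d s j"
      using inhomogeneous_dissipation[of d s "V s" j "at_bdry d S_tilde s (V s) j"] rot bc s j
      unfolding Let_def by blast
    moreover have "0 \<le> ds d j" using d j by (auto simp: sbp_scheme_def intro: less_imp_le)
    ultimately have "ds d j * - bdry_dissipation d s (V s) j \<le> ds d j * (Gbdry d s j \<bullet> Gbdry d s j)"
      by (rule mult_left_mono)
    then show "- (ds d j * bdry_dissipation d s (V s) j) \<le> (Gbdry d s j \<bullet> Gbdry d s j) * ds d j"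
      by (simp add: mult.commute)
  qed
  then show "energy d (V t) \<le> energy d (Fvec d) + 2 * integral {0..t} (bdry_data_sq d)"
    using energy_estimate[OF d sol _ t] int rot t by blast
qed

end
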